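(* Let $d\in\{2,3\}$, let $S$ be a homogeneous Poisson process in $\mathbb{R}^d$, and let $S^{\circ}$ be its Palm version. Then there exist a measurable set $\mathcal{S}^{\circ}$ of locally finite subsets of $\mathbb{R}^d$ containing $0$, with $\mathbb{P}(S^{\circ}\in\mathcal{S}^{\circ})=1$, and measurable maps $\pi_n:\mathcal{S}^{\circ}\to\mathbb{R}^d$, $n\in\mathbb{Z}$, with $\pi_0\equiv 0$, such that for every $\omega\in\mathcal{S}^{\circ}$ the points $\pi_n(\omega)$, $n\in\mathbb{Z}$, are pairwise distinct and $$\omega=\{\pi_n(\omega): n\in\mathbb{Z}\},$$ and such that for every $n\in\mathbb{Z}$ the map $\theta_{\pi_n}:\mathcal{S}^{\circ}\to\mathcal{S}^{\circ}$, $\theta_{\pi_n}(\omega)=\omega-\pi_n(\omega)$, is well defined and bijective. Consequently, with $X_n=\pi_n(S^{\circ})$, for every $n\in\mathbb{Z}$ the random set $S^{\circ}-X_n$ has the same distribution as $S^{\circ}$.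
   Context: The Palm version $S^{\circ}$ of the Poisson process $S$ is a random set with the same distribution as $S\cup\{0\}$. For a set $\omega\subset\mathbb{R}^d$ and $x\in\mathbb{R}^d$, $\omega-x=\{s-x:s\in\omega\}$. Locally finite configurations carry the usual $\sigma$-algebra generated by the counting maps $\omega\mapsto|\omega\cap A|$, $A$ bounded Borel. *)

theory Defs
  imports "HOL-Probability.Probability"
begin

definition locally_finite :: "'a::metric_space set \<Rightarrow> bool" where
  "locally_finite \<omega> \<longleftrightarrow> (\<forall>A. bounded A \<longrightarrow> finite (\<omega> \<inter> A))"

definition configs :: "'a::metric_space set measure" where
  "configs = sigma {\<omega>. locally_finite \<omega>}
     {{\<omega>. locally_finite \<omega> \<and> card (\<omega> \<inter> A) \<in> K} | A K. A \<in> sets borel \<and> bounded A}"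

definition translate_config :: "'a::ab_group_add set \<Rightarrow> 'a \<Rightarrow> 'a set" where
  "translate_config \<omega> x = (\<lambda>s. s - x) ` \<omega>"

text \<open>The Poisson probabilities are written out, since the library's \<open>poisson_pmf\<close> is specified only
  for positive rates, while a bounded Borel set may have volume 0 (then the count is almost surely 0,
  as \<open>0 ^ 0 = 1\<close>).\<close>

definition homogeneous_poisson_process ::
    "'p measure \<Rightarrow> ('p \<Rightarrow> 'a::euclidean_space set) \<Rightarrow> real \<Rightarrow> bool" where
  "homogeneous_poisson_process M S lam \<longleftrightarrow>
     prob_space M \<and> lam > 0 \<and> S \<in> M \<rightarrow>\<^sub>M configs \<and>
     (\<forall>A k. A \<in> sets borel \<and> bounded A \<longrightarrow>
        measure M {x \<in> space M. card (S x \<inter> A) = k}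
          = exp (- (lam * measure lborel A)) * (lam * measure lborel A) ^ k / fact k) \<and>
     (\<forall>(A :: nat \<Rightarrow> 'a set) m. (\<forall>i<m. A i \<in> sets borel \<and> bounded (A i)) \<and>
        disjoint_family_on A {..<m} \<longrightarrow>
        prob_space.indep_vars M (\<lambda>_. count_space UNIV) (\<lambda>i x. card (S x \<inter> A i)) {..<m})"

definition same_distribution ::
    "'c measure \<Rightarrow> 'p measure \<Rightarrow> ('p \<Rightarrow> 'c) \<Rightarrow> 'q measure \<Rightarrow> ('q \<Rightarrow> 'c) \<Rightarrow> bool" where
  "same_distribution E M X N Y \<longleftrightarrow>
     X \<in> M \<rightarrow>\<^sub>M E \<and> Y \<in> N \<rightarrow>\<^sub>M E \<and> distr M E X = distr N E Y"

definition palm_version ::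
    "'p measure \<Rightarrow> ('p \<Rightarrow> 'a::euclidean_space set) \<Rightarrow> 'q measure \<Rightarrow> ('q \<Rightarrow> 'a set) \<Rightarrow> bool" where
  "palm_version M S N S0 \<longleftrightarrow>
     prob_space N \<and> same_distribution configs N S0 M (\<lambda>x. S x \<union> {0})"

text \<open>The measurability of \<open>S \<union> {0}\<close> demanded above is no restriction:\<close>

lemma space_configs: "space configs = {\<omega>. locally_finite \<omega>}"
  unfolding configs_def by (rule space_measure_of) auto

lemma sets_configs_count:
  assumes "A \<in> sets borel" "bounded A"
  shows "{\<omega>. locally_finite \<omega> \<and> card (\<omega> \<inter> A) \<in> K} \<in> sets configs"
  unfolding configs_def using assms by (subst sets_measure_of) (auto intro!: sigma_sets.Basic)

lemma measurable_insert_zero: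
  "(\<lambda>\<omega>. \<omega> \<union> {0 :: 'a::euclidean_space}) \<in> configs \<rightarrow>\<^sub>M configs"
proof -
  have lf: "locally_finite (\<omega> \<union> {0})" if "locally_finite \<omega>" for \<omega> :: "'a set"
    using that by (auto simp: locally_finite_def Int_insert_left)
  have count: "(\<lambda>\<omega>. card (\<omega> \<inter> A)) \<in> configs \<rightarrow>\<^sub>M count_space UNIV"
    if "A \<in> sets borel" "bounded A" for A :: "'a set"
  proof (rule measurableI)
    fix K :: "nat set"
    have "(\<lambda>\<omega>. card (\<omega> \<inter> A)) -` K \<inter> space configs = {\<omega>. locally_finite \<omega> \<and> card (\<omega> \<inter> A) \<in> K}"
      by (auto simp: space_configs)
    then show "(\<lambda>\<omega>. card (\<omega> \<inter> A)) -` K \<inter> space configs \<in> sets configs"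
      using sets_configs_count[OF that] by simp
  qed auto
  show ?thesis
  proof (subst (2) configs_def, rule measurable_measure_of)
    show "(\<lambda>\<omega>. \<omega> \<union> {0}) \<in> space configs \<rightarrow> {\<omega> :: 'a set. locally_finite \<omega>}"
      using lf by (auto simp: space_configs)
  next
    fix Y assume "Y \<in> {{\<omega> :: 'a set. locally_finite \<omega> \<and> card (\<omega> \<inter> A) \<in> K} | A K.
      A \<in> sets borel \<and> bounded A}"
    then obtain A K where Y: "Y = {\<omega>. locally_finite \<omega> \<and> card (\<omega> \<inter> A) \<in> K}"
      and A: "A \<in> sets borel" "bounded A" by auto
    let ?f = "\<lambda>\<omega> :: 'a set. card (\<omega> \<inter> A) + (if 0 \<in> A then 1 - card (\<omega> \<inter> {0}) else 0)"
    have m: "?f \<in> configs \<rightarrow>\<^sub>M count_space UNIV"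
      using count[OF A] count[of "{0}"] by measurable
    have eq: "card ((\<omega> \<union> {0}) \<inter> A) = ?f \<omega>" if "locally_finite \<omega>" for \<omega>
    proof -
      have "finite (\<omega> \<inter> A)" using that A by (auto simp: locally_finite_def)
      then show ?thesis by (cases "0 \<in> \<omega>") (auto simp: Int_insert_left insert_absorb)
    qed
    have "(\<lambda>\<omega>. \<omega> \<union> {0}) -` Y \<inter> space configs = ?f -` K \<inter> space configs"
      using lf eq by (auto simp: Y space_configs)
    also have "\<dots> \<in> sets configs" by (rule measurable_sets[OF m]) simp
    finally show "(\<lambda>\<omega>. \<omega> \<union> {0}) -` Y \<inter> space configs \<in> sets configs" .
  qed auto
qed

end

theory Submission
  imports Defs
begin

text \<open>
  The shifts come from a decomposition of the complete digraph on the points of a configuration \<open>\<omega>\<close>,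
  loops included, into perfect matchings, that is, into permutations of \<open>\<omega>\<close>, which depends on \<open>\<omega>\<close> only
  up to translation. The map \<open>\<pi>\<^sub>n\<close> picks the point to which the \<open>n\<close>-th matching joins the origin; the
  0-th matching is the diagonal. The matchings are disjoint and exhaust all edges, so each point is
  picked once. After the origin has moved to \<open>\<pi>\<^sub>n(\<omega>)\<close>, the old origin is the only point joined to the
  new one by the \<open>n\<close>-th matching, so the shift is invertible (\<open>bij_betw_shift\<close>).

  The matchings are built greedily. Edges carry countably many colours, determined by small cells that
  contain the difference vector, and each colour class is a matching (\<open>matching_edges\<close>,
  \<open>edges_cover\<close>). Layer \<open>n\<close> runs through the colours and accepts every edge that no earlier layer has
  spent and that meets no edge accepted so far with the same source or target. An edge is refused only
  for one of finitely many edges of smaller colour, each of which is spent once, so every edge belongs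
  to some layer (\<open>layers_exhaust\<close>). If a point has no outgoing edge in layer \<open>n\<close>, then at most \<open>n\<close>
  points have no incoming edge (\<open>deficient_layer\<close>).

  Perfectness is almost sure only, and rests on the mass transport principle for the Palm version
  \<open>S\<^sup>0\<close> of a Poisson process: the sum of \<open>g(S\<^sup>0, y)\<close> over the points \<open>y\<close> of \<open>S\<^sup>0\<close> has the same mean as
  the sum of \<open>g(S\<^sup>0 - y, - y)\<close> (\<open>mass_transport\<close>). It follows from the Mecke formula (\<open>mecke\<close>) and
  stationarity. By this principle the origin is almost surely not one of finitely many points that are
  selected equivariantly from the infinite configuration (\<open>AE_palm_not_few\<close>), and it has an outgoing
  and an incoming edge with equal probabilities (\<open>palm_Domain_eq_Range\<close>). Together with the bound on
  the deficiency this makes each layer almost surely a permutation (\<open>AE_palm_layer\<close>). The same principle,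
  with mass sent along layer \<open>n\<close>, shows that the shifts preserve the law of \<open>S\<^sup>0\<close>
  (\<open>palm_shift_invariant\<close>).
\<close>

section \<open>Greedy exhaustion of an edge-coloured complete digraph\<close>

definition matching :: "'b rel \<Rightarrow> bool" where
  "matching R \<longleftrightarrow> single_valued R \<and> single_valued (R\<inverse>)"

fun greedy_upto :: "(nat \<Rightarrow> 'b rel) \<Rightarrow> 'b rel \<Rightarrow> nat \<Rightarrow> 'b rel" where
  "greedy_upto E W 0 = {}"
| "greedy_upto E W (Suc k) = greedy_upto E W k \<union>
     {(x, y) \<in> E k - W. x \<notin> Domain (greedy_upto E W k) \<and> y \<notin> Range (greedy_upto E W k)}"

definition greedy :: "(nat \<Rightarrow> 'b rel) \<Rightarrow> 'b rel \<Rightarrow> 'b rel" where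
  "greedy E W = (\<Union>k. greedy_upto E W k)"

fun used :: "(nat \<Rightarrow> 'b rel) \<Rightarrow> nat \<Rightarrow> 'b rel" where
  "used E 0 = {}"
| "used E (Suc n) = used E n \<union> greedy E (used E n)"

definition layer :: "(nat \<Rightarrow> 'b rel) \<Rightarrow> nat \<Rightarrow> 'b rel" where
  "layer E n = greedy E (used E n)"

lemma greedy_upto_mono: "i \<le> j \<Longrightarrow> greedy_upto E W i \<subseteq> greedy_upto E W j"
  by (induction rule: dec_induct) auto

lemma greedy_upto_subset: "greedy_upto E W k \<subseteq> (\<Union>j<k. E j) - W"
  by (induction k) (auto simp: lessThan_Suc)

lemma matchingD:
  assumes "matching R"
  shows "(x, y) \<in> R \<Longrightarrow> (x, y') \<in> R \<Longrightarrow> y = y'" "(x, y) \<in> R \<Longrightarrow> (x', y) \<in> R \<Longrightarrow> x = x'"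
  using assms unfolding matching_def single_valued_def by blast+

lemma matching_the:
  assumes "matching R" "(x, y) \<in> R"
  shows "(THE y. (x, y) \<in> R) = y" "(THE x. (x, y) \<in> R) = x"
  using assms by (auto simp: matching_def single_valued_def intro!: the_equality)

lemma matching_subset: "matching R \<Longrightarrow> R' \<subseteq> R \<Longrightarrow> matching R'"
  unfolding matching_def by (meson single_valued_subset converse_mono)

lemma matching_Un:
  assumes "matching R" "matching R'" "Domain R \<inter> Domain R' = {}" "Range R \<inter> Range R' = {}"
  shows "matching (R \<union> R')"
  using assms unfolding matching_def single_valued_def by (simp add: disjoint_iff Domain_iff Range_iff) blast

lemma matching_greedy_upto:
  assumes "\<And>k. matching (E k)"
  shows "matching (greedy_upto E W k)"
proof (induction k)
  case (Suc k)
  show ?case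
    unfolding greedy_upto.simps
    by (rule matching_Un[OF Suc matching_subset[OF assms[of k]]]) auto
qed (auto simp: matching_def)

lemma matching_chain_UN:
  assumes "\<And>k::nat. matching (G k)" "mono G"
  shows "matching (\<Union>k. G k)"
proof -
  have both: "\<exists>k. e \<in> G k \<and> e' \<in> G k" if "e \<in> G i" "e' \<in> G j" for e e' i j
    using that monoD[OF assms(2), of i "max i j"] monoD[OF assms(2), of j "max i j"] by auto
  have sv: "y = y'" if "(x, y) \<in> G i" "(x, y') \<in> G j" for x y y' i j
    using both[OF that] assms(1) unfolding matching_def single_valued_def by blast
  have inj: "x = x'" if "(x, y) \<in> G i" "(x', y) \<in> G j" for x x' y i j
    using both[OF that] assms(1) unfolding matching_def single_valued_def by blast
  show ?thesis
    using sv inj unfolding matching_def single_valued_def by auto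
qed

lemma matching_greedy:
  assumes "\<And>k. matching (E k)"
  shows "matching (greedy E W)"
  unfolding greedy_def
  by (intro matching_chain_UN matching_greedy_upto assms monoI greedy_upto_mono)

lemma used_eq_layers: "used E n = (\<Union>m<n. layer E m)"
  by (induction n) (auto simp: layer_def less_Suc_eq)

lemma layer_disjoint_used: "layer E n \<inter> used E n = {}"
  using greedy_upto_subset[of E "used E n"] by (auto simp: layer_def greedy_def)

lemma layers_disjoint: "m \<noteq> n \<Longrightarrow> layer E m \<inter> layer E n = {}"
proof (induction m n rule: linorder_wlog)
  case (le m n)
  then have "layer E m \<subseteq> used E n" by (force simp: used_eq_layers)
  then show ?case using layer_disjoint_used[of E n] by auto
qed auto

lemma matching_layer: "(\<And>k. matching (E k)) \<Longrightarrow> matching (layer E n)"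
  by (simp add: layer_def matching_greedy)

lemma layer_subset: "(\<And>k. E k \<subseteq> A) \<Longrightarrow> layer E n \<subseteq> A"
  using greedy_upto_subset[of E "used E n"] by (fastforce simp: layer_def greedy_def)

text \<open>The only reason for an edge of colour \<open>k\<close> to be refused is an edge of smaller colour that was
  accepted before it and shares its source or its target.\<close>

lemma layer_maximal:
  assumes "(x, y) \<in> E k" "(x, y) \<notin> used E (Suc n)"
  obtains e where "e \<in> layer E n" "e \<in> (\<Union>j<k. E j)" "fst e = x \<or> snd e = y"
proof -
  from assms have "(x, y) \<notin> greedy_upto E (used E n) (Suc k)" "(x, y) \<notin> used E n"
    by (auto simp: greedy_def simp del: greedy_upto.simps)
  with assms(1) obtain e where e: "e \<in> greedy_upto E (used E n) k" "fst e = x \<or> snd e = y"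
    by force
  show thesis
    using that[OF _ _ e(2)] e(1) greedy_upto_subset[of E "used E n" k]
    by (auto simp: layer_def greedy_def)
qed

text \<open>An edge of colour \<open>k\<close> is refused by a layer only in favour of an adjacent edge of a smaller
  colour. There are at most two such edges for each smaller colour, and each of them is spent
  once only, so an edge cannot be refused forever.\<close>

lemma layers_exhaust:
  assumes M: "\<And>k. matching (E k)" and xy: "(x, y) \<in> E k"
  shows "\<exists>n. (x, y) \<in> layer E n"
proof (rule ccontr)
  assume "\<not> ?thesis"
  then have "\<forall>n. (x, y) \<notin> used E (Suc n)" by (auto simp: used_eq_layers)
  then have "(x, y) \<notin> used E (Suc n)" for n by blast
  from layer_maximal[OF xy this] have "\<exists>e. e \<in> layer E n \<and> e \<in> (\<Union>j<k. E j) \<and> (fst e = x \<or> snd e = y)" for n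
    by metis
  then obtain e where e: "\<And>n. e n \<in> layer E n" "\<And>n. e n \<in> (\<Union>j<k. E j)"
      "\<And>n. fst (e n) = x \<or> snd (e n) = y"
    by metis
  \<comment> \<open>The edges that can block \<open>(x, y)\<close>.\<close>
  let ?B = "(\<Union>j<k. {e \<in> E j. fst e = x} \<union> {e \<in> E j. snd e = y})"
  have "finite {e \<in> E j. fst e = x}" "finite {e \<in> E j. snd e = y}" for j
  proof -
    have "{e \<in> E j. fst e = x} \<subseteq> {(x, THE y. (x, y) \<in> E j)}"
      using matching_the(1)[OF M] by auto
    then show "finite {e \<in> E j. fst e = x}" by (rule finite_subset) simp
    have "{e \<in> E j. snd e = y} \<subseteq> {(THE x. (x, y) \<in> E j, y)}"
      using matching_the(2)[OF M] by auto
    then show "finite {e \<in> E j. snd e = y}" by (rule finite_subset) simp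
  qed
  then have "finite ?B" by auto
  moreover have "range e \<subseteq> ?B" using e by fastforce
  moreover have "inj e"
    using e(1) layers_disjoint[of _ _ E] by (intro injI) (metis disjoint_iff)
  ultimately show False
    using finite_subset finite_imageD by blast
qed

text \<open>An edge from a point without outgoing edge to a point without incoming edge meets no edge of the
  layer, so maximality says that an earlier layer has spent it. Each earlier layer spends at most one
  edge with a given source.\<close>

lemma deficient_layer:
  assumes M: "\<And>k. matching (E k)" and cover: "A \<times> A \<subseteq> (\<Union>k. E k)"
    and x: "x \<in> A" "x \<notin> Domain (layer E n)"
  shows "finite (A - Range (layer E n))" "card (A - Range (layer E n)) \<le> n"
proof -
  let ?V = "A - Range (layer E n)"
  have "(x, y) \<in> used E n" if y: "y \<in> ?V" for y
  proof (rule ccontr)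
    assume nu: "(x, y) \<notin> used E n"
    obtain k where k: "(x, y) \<in> E k" using cover x y by blast
    have "(x, y) \<notin> used E (Suc n)" using nu x(2) by (auto simp: layer_def)
    from layer_maximal[OF k this] x(2) y show False by (metis DiffD2 Domain.simps Range.simps prod.collapse)
  qed
  then have "?V \<subseteq> (\<lambda>m. THE y. (x, y) \<in> layer E m) ` {..<n}"
    using matching_the(1)[OF matching_layer[OF M]] by (fastforce simp: used_eq_layers image_iff)
  then show "finite ?V" "card ?V \<le> n"
    by (auto intro: finite_subset dest: surj_card_le[OF finite_lessThan])
qed

lemma layer_0:
  assumes "E 0 = Id_on A" "\<And>k. E k \<subseteq> A \<times> A"
  shows "layer E 0 = Id_on A"
proof -
  have G: "greedy_upto E {} (Suc k) = Id_on A" for k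
  proof (induction k)
    case (Suc k)
    have "{(x, y) \<in> E (Suc k) - {}. x \<notin> Domain (Id_on A) \<and> y \<notin> Range (Id_on A)} = {}"
      using assms(2)[of "Suc k"] by auto
    then show ?case by (subst greedy_upto.simps) (simp only: Suc Un_empty_right)
  qed (use assms(1) in auto)
  have "greedy_upto E {} k \<subseteq> Id_on A" for k
    using G by (cases k) (simp, blast)
  moreover have "greedy_upto E {} (Suc 0) = Id_on A" by (rule G)
  ultimately show ?thesis unfolding layer_def greedy_def used.simps by blast
qed

text \<open>Greedy choices are made by colour alone, hence commute with relabelling the vertices. This is what
  makes the layers of a configuration equivariant under translations.\<close>

lemma greedy_upto_inv_image:
  assumes "surj h"
  shows "greedy_upto (\<lambda>k. inv_image (E k) h) (inv_image W h) k = inv_image (greedy_upto E W k) h"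
proof (induction k)
  case (Suc k)
  have "x \<in> Domain (inv_image R h) \<longleftrightarrow> h x \<in> Domain R" "x \<in> Range (inv_image R h) \<longleftrightarrow> h x \<in> Range R" for x R
    using assms by (auto simp: Domain_iff Range_iff in_inv_image) (metis surjD)+
  with Suc show ?case by (auto simp: in_inv_image)
qed (auto simp: inv_image_def)

lemma used_inv_image:
  assumes "surj h"
  shows "used (\<lambda>k. inv_image (E k) h) n = inv_image (used E n) h"
proof (induction n)
  case (Suc n)
  then show ?case
    by (simp add: greedy_def greedy_upto_inv_image[OF assms]) (auto simp: inv_image_def)
qed (auto simp: inv_image_def)

lemma layer_inv_image:
  assumes "surj h"
  shows "layer (\<lambda>k. inv_image (E k) h) n = inv_image (layer E n) h"
  by (simp add: layer_def greedy_def used_inv_image[OF assms] greedy_upto_inv_image[OF assms])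
    (auto simp: inv_image_def)

section \<open>Measurability on the space of configurations\<close>

lemma locally_finite_Int: "locally_finite \<omega> \<Longrightarrow> bounded A \<Longrightarrow> finite (\<omega> \<inter> A)"
  by (simp add: locally_finite_def)

lemma measurable_configsI:
  fixes f :: "'b \<Rightarrow> 'a::metric_space set"
  assumes "\<And>z. z \<in> space L \<Longrightarrow> locally_finite (f z)"
    and "\<And>A. A \<in> sets borel \<Longrightarrow> bounded A \<Longrightarrow> (\<lambda>z. card (f z \<inter> A)) \<in> L \<rightarrow>\<^sub>M count_space UNIV"
  shows "f \<in> L \<rightarrow>\<^sub>M configs"
  unfolding configs_def
proof (rule measurable_measure_of)
  fix Y assume "Y \<in> {{\<omega> :: 'a set. locally_finite \<omega> \<and> card (\<omega> \<inter> A) \<in> K} | A K. A \<in> sets borel \<and> bounded A}"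
  then obtain A K where Y: "Y = {\<omega>. locally_finite \<omega> \<and> card (\<omega> \<inter> A) \<in> K}"
    and A: "A \<in> sets borel" "bounded A" by auto
  have "f -` Y \<inter> space L = (\<lambda>z. card (f z \<inter> A)) -` K \<inter> space L"
    using assms(1) by (auto simp: Y)
  then show "f -` Y \<inter> space L \<in> sets L"
    using measurable_sets[OF assms(2)[OF A], of K] by simp
qed (use assms(1) in auto)

lemma measurable_card_configs:
  assumes "A \<in> sets borel" "bounded A"
  shows "(\<lambda>\<omega>. card (\<omega> \<inter> A)) \<in> configs \<rightarrow>\<^sub>M count_space UNIV"
proof (rule measurableI)
  fix K :: "nat set"
  have "(\<lambda>\<omega>. card (\<omega> \<inter> A)) -` K \<inter> space configs = {\<omega>. locally_finite \<omega> \<and> card (\<omega> \<inter> A) \<in> K}"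
    by (auto simp: space_configs)
  then show "(\<lambda>\<omega>. card (\<omega> \<inter> A)) -` K \<inter> space configs \<in> sets configs"
    using sets_configs_count[OF assms] by simp
qed auto

text \<open>Points are isolated by the sets of a fixed countable family. The singleton \<open>{0}\<close> comes first
  because the family also colours the edges of a configuration, and then colour 0 is the diagonal.\<close>

lemma ex_cells:
  "\<exists>Q :: nat \<Rightarrow> 'a::euclidean_space set. Q 0 = {0} \<and> (\<forall>k. Q k \<in> sets borel \<and> bounded (Q k)) \<and>
     (\<forall>x r. 0 < r \<longrightarrow> (\<exists>k. x \<in> Q k \<and> Q k \<subseteq> ball x r))"
proof -
  obtain D :: "'a set" where D: "countable D" "\<And>X. open X \<Longrightarrow> X \<noteq> {} \<Longrightarrow> \<exists>d\<in>D. d \<in> X"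
    by (rule countable_dense_setE) blast
  define B where "B = (\<lambda>(d, n). ball d (1 / real (Suc n))) ` (D \<times> UNIV)"
  have "countable B" "B \<noteq> {}"
    using D(1) D(2)[of UNIV] by (auto simp: B_def)
  then have range: "range (from_nat_into B) = B" by (simp add: range_from_nat_into)
  have B: "b \<in> sets borel \<and> bounded b" if "b \<in> B" for b
    using that by (auto simp: B_def)
  have small: "\<exists>b\<in>B. x \<in> b \<and> b \<subseteq> ball x r" if "0 < r" for x :: 'a and r :: real
  proof -
    have "0 < r / 2" using that by simp
    then obtain n where n: "inverse (real (Suc n)) < r / 2" using reals_Archimedean by blast
    obtain d where d: "d \<in> D" "d \<in> ball x (1 / Suc n)" using D(2)[of "ball x (1 / Suc n)"] by auto
    have "ball d (1 / real (Suc n)) \<subseteq> ball x r"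
    proof
      fix y assume "y \<in> ball d (1 / real (Suc n))"
      then show "y \<in> ball x r" using d(2) n dist_triangle[of x y d] by (auto simp: inverse_eq_divide)
    qed
    with d show ?thesis by (auto simp: B_def dist_commute intro!: bexI[of _ d] exI[of _ n])
  qed
  let ?Q = "\<lambda>k. case k of 0 \<Rightarrow> {0} | Suc j \<Rightarrow> from_nat_into B j"
  have "?Q k \<in> sets borel \<and> bounded (?Q k)" for k
    using B[OF from_nat_into[OF \<open>B \<noteq> {}\<close>]] by (auto split: nat.split)
  moreover have "\<exists>k. x \<in> ?Q k \<and> ?Q k \<subseteq> ball x r" if r: "0 < r" for x :: 'a and r :: real
  proof -
    obtain b where b: "b \<in> B" "x \<in> b" "b \<subseteq> ball x r" using small[OF r] by blast
    then obtain j where "from_nat_into B j = b" using range by (metis imageE)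
    with b show ?thesis by (intro exI[of _ "Suc j"]) auto
  qed
  ultimately show ?thesis by (intro exI[of _ ?Q]) auto
qed

definition cell :: "nat \<Rightarrow> 'a::euclidean_space set" where
  "cell = (SOME Q. Q 0 = {0} \<and> (\<forall>k. Q k \<in> sets borel \<and> bounded (Q k)) \<and>
     (\<forall>x r. 0 < r \<longrightarrow> (\<exists>k. x \<in> Q k \<and> Q k \<subseteq> ball x r)))"

lemma cell_0: "cell 0 = {0}"
  and cell_borel [measurable]: "cell k \<in> sets borel"
  and bounded_cell: "bounded (cell k)"
  and small_cell: "0 < r \<Longrightarrow> \<exists>k. x \<in> cell k \<and> cell k \<subseteq> ball x r"
  using someI_ex[OF ex_cells] unfolding cell_def by blast+

lemma isolating_ball:
  assumes "locally_finite \<omega>"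
  obtains r where "0 < r" "\<omega> \<inter> ball x r \<subseteq> {x}"
proof -
  have "finite (\<omega> \<inter> ball x 1)" using assms by (intro locally_finite_Int) auto
  from finite_set_avoid[OF this, of x] obtain d
    where "0 < d" "\<And>y. y \<in> \<omega> \<inter> ball x 1 \<Longrightarrow> y \<noteq> x \<Longrightarrow> d \<le> dist x y" by blast
  then show thesis by (intro that[of "min 1 d"]) force+
qed

text \<open>Choosing the point of \<open>\<omega>\<close> that a cell singles out turns quantifiers and sums over the points of \<open>\<omega>\<close>
  into countable ones, with measurable terms.\<close>

definition singled_out :: "nat \<Rightarrow> 'a::euclidean_space set \<Rightarrow> bool" where
  "singled_out k \<omega> \<longleftrightarrow> card (\<omega> \<inter> cell k) = 1"

definition point :: "nat \<Rightarrow> 'a::euclidean_space set \<Rightarrow> 'a" where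
  "point k \<omega> = (if singled_out k \<omega> then the_elem (\<omega> \<inter> cell k) else 0)"

lemma singled_out_iff: "singled_out k \<omega> \<longleftrightarrow> \<omega> \<inter> cell k = {point k \<omega>}"
  by (metis card_1_singletonE is_singletonI is_singleton_altdef point_def singled_out_def the_elem_eq)

lemma points_exhaust:
  assumes "locally_finite \<omega>"
  shows "\<omega> = {point k \<omega> | k. singled_out k \<omega>}"
proof
  show "\<omega> \<subseteq> {point k \<omega> | k. singled_out k \<omega>}"
  proof
    fix x assume "x \<in> \<omega>"
    obtain r where r: "0 < r" "\<omega> \<inter> ball x r \<subseteq> {x}" by (rule isolating_ball[OF assms])
    obtain k where "x \<in> cell k" "cell k \<subseteq> ball x r" using small_cell[OF r(1)] by blast
    with r \<open>x \<in> \<omega>\<close> have *: "\<omega> \<inter> cell k = {x}" by auto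
    then have "singled_out k \<omega>" by (simp add: singled_out_def)
    with * show "x \<in> {point k \<omega> | k. singled_out k \<omega>}" by (auto simp: singled_out_iff)
  qed
qed (auto simp: singled_out_iff)

lemma measurable_singled_out [measurable]: "Measurable.pred configs (singled_out k)"
proof -
  have [measurable]: "(\<lambda>\<omega>. card (\<omega> \<inter> cell k)) \<in> configs \<rightarrow>\<^sub>M count_space UNIV"
    by (intro measurable_card_configs cell_borel bounded_cell)
  show ?thesis unfolding singled_out_def[abs_def] by measurable
qed

lemma measurable_point [measurable]: "point k \<in> configs \<rightarrow>\<^sub>M borel"
proof (rule measurableI)
  fix A :: "'a set" assume A: "A \<in> sets borel"
  have [measurable]: "(\<lambda>\<omega>. card (\<omega> \<inter> (cell k \<inter> A))) \<in> configs \<rightarrow>\<^sub>M count_space UNIV"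
    using A bounded_cell by (intro measurable_card_configs) (auto intro: bounded_Int)
  have "point k -` A \<inter> space configs =
     {\<omega> \<in> space configs. if singled_out k \<omega> then card (\<omega> \<inter> (cell k \<inter> A)) = 1 else 0 \<in> A}"
  proof -
    have "card (\<omega> \<inter> (cell k \<inter> A)) = 1 \<longleftrightarrow> point k \<omega> \<in> A" if "singled_out k \<omega>" for \<omega>
    proof -
      have "\<omega> \<inter> (cell k \<inter> A) = {point k \<omega>} \<inter> A" using that unfolding singled_out_iff by auto
      then show ?thesis by (cases "point k \<omega> \<in> A") auto
    qed
    then show ?thesis by (auto simp: point_def)
  qed
  also have "\<dots> \<in> sets configs" by measurable
  finally show "point k -` A \<inter> space configs \<in> sets configs" .
qed simp

lemma pred_bex_points:
  fixes f :: "'b \<Rightarrow> 'a::euclidean_space set"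
  assumes f: "f \<in> L \<rightarrow>\<^sub>M configs"
    and P: "Measurable.pred (L \<Otimes>\<^sub>M borel) (\<lambda>(z, y). P z y)"
  shows "Measurable.pred L (\<lambda>z. \<exists>y\<in>f z. P z y)"
proof -
  have "(\<exists>y\<in>f z. P z y) \<longleftrightarrow> (\<exists>k. singled_out k (f z) \<and> P z (point k (f z)))" if "z \<in> space L" for z
  proof -
    have "locally_finite (f z)" using measurable_space[OF f that] by (simp add: space_configs)
    then show ?thesis by (subst points_exhaust) auto
  qed
  moreover have "Measurable.pred L (\<lambda>z. P z (point k (f z)))" for k
    using measurable_compose[OF _ P, of "\<lambda>z. (z, point k (f z))" L] f by simp
  then have "Measurable.pred L (\<lambda>z. \<exists>k. singled_out k (f z) \<and> P z (point k (f z)))"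
    using f by measurable
  ultimately show ?thesis by (simp cong: measurable_cong)
qed

lemma pred_ball_points:
  fixes f :: "'b \<Rightarrow> 'a::euclidean_space set"
  assumes "f \<in> L \<rightarrow>\<^sub>M configs" "Measurable.pred (L \<Otimes>\<^sub>M borel) (\<lambda>(z, y). P z y)"
  shows "Measurable.pred L (\<lambda>z. \<forall>y\<in>f z. P z y)"
proof -
  have "Measurable.pred L (\<lambda>z. \<not> (\<exists>y\<in>f z. \<not> P z y))"
    by (intro pred_intros_logic pred_bex_points assms) (use assms(2) in \<open>simp add: split_beta\<close>)
  then show ?thesis by simp
qed

lemma pred_mem_configs [measurable (raw)]:
  fixes g :: "'b \<Rightarrow> 'a::euclidean_space"
  assumes [measurable]: "f \<in> L \<rightarrow>\<^sub>M configs" "g \<in> L \<rightarrow>\<^sub>M borel"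
  shows "Measurable.pred L (\<lambda>z. g z \<in> f z)"
proof -
  have "Measurable.pred L (\<lambda>z. \<exists>y\<in>f z. y = g z)"
    by (rule pred_bex_points) (simp_all add: split_beta)
  then show ?thesis by simp
qed

definition first_singled_out :: "nat \<Rightarrow> 'a::euclidean_space set \<Rightarrow> bool" where
  "first_singled_out k \<omega> \<longleftrightarrow> singled_out k \<omega> \<and> (\<forall>j<k. \<not> (singled_out j \<omega> \<and> point j \<omega> = point k \<omega>))"

lemma measurable_first_singled_out [measurable]: "Measurable.pred configs (first_singled_out k)"
  unfolding first_singled_out_def[abs_def] by measurable

lemma bij_betw_first_singled_out:
  assumes "locally_finite \<omega>"
  shows "bij_betw (\<lambda>k. point k \<omega>) {k. first_singled_out k \<omega>} \<omega>"
  unfolding bij_betw_def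
proof
  show "inj_on (\<lambda>k. point k \<omega>) {k. first_singled_out k \<omega>}"
    by (rule inj_onI) (metis first_singled_out_def linorder_neqE_nat mem_Collect_eq)
  have "\<exists>k. first_singled_out k \<omega> \<and> point k \<omega> = x" if "x \<in> \<omega>" for x
  proof -
    have "x \<in> {point k \<omega> | k. singled_out k \<omega>}"
      by (rule subst[of \<omega> "{point k \<omega> | k. singled_out k \<omega>}" "\<lambda>A. x \<in> A", OF points_exhaust[OF assms] that])
    then have "\<exists>k. singled_out k \<omega> \<and> point k \<omega> = x" by auto
    then obtain k where "singled_out k \<omega> \<and> point k \<omega> = x" "\<And>j. j < k \<Longrightarrow> \<not> (singled_out j \<omega> \<and> point j \<omega> = x)"
      using exists_least_iff[of "\<lambda>k. singled_out k \<omega> \<and> point k \<omega> = x"] by metis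
    then show ?thesis unfolding first_singled_out_def by blast
  qed
  then show "(\<lambda>k. point k \<omega>) ` {k. first_singled_out k \<omega>} = \<omega>"
    by (auto simp: first_singled_out_def singled_out_iff)
qed

lemma nn_integral_points:
  assumes "locally_finite \<omega>"
  shows "(\<integral>\<^sup>+y. h y \<partial>count_space \<omega>) =
    (\<integral>\<^sup>+k. indicator {k. first_singled_out k \<omega>} k * h (point k \<omega>) \<partial>count_space UNIV)"
  by (subst nn_integral_bij_count_space[OF bij_betw_first_singled_out[OF assms], symmetric])
    (simp add: nn_integral_count_space_indicator mult.commute)

lemma measurable_nn_integral_points:
  fixes f :: "'b \<Rightarrow> 'a::euclidean_space set"
  assumes f [measurable]: "f \<in> L \<rightarrow>\<^sub>M configs" and h: "h \<in> borel_measurable (L \<Otimes>\<^sub>M borel)"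
  shows "(\<lambda>z. \<integral>\<^sup>+y. h (z, y) \<partial>count_space (f z)) \<in> borel_measurable L"
proof -
  have "(\<integral>\<^sup>+y. h (z, y) \<partial>count_space (f z)) =
      (\<Sum>k. of_bool (first_singled_out k (f z)) * h (z, point k (f z)))" if "z \<in> space L" for z
    using measurable_space[OF f that]
    by (simp add: space_configs nn_integral_points nn_integral_count_space_nat indicator_def of_bool_def
        cong: if_cong)
  moreover have [measurable]: "(\<lambda>z. h (z, point k (f z))) \<in> borel_measurable L" for k
    using measurable_compose[OF _ h, of "\<lambda>z. (z, point k (f z))" L] by simp
  have "(\<lambda>z. \<Sum>k. of_bool (first_singled_out k (f z)) * h (z, point k (f z))) \<in> borel_measurable L"
    unfolding of_bool_def by measurable
  ultimately show ?thesis by (simp cong: measurable_cong)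
qed

lemma measurable_insert_point [measurable (raw)]:
  fixes g :: "'b \<Rightarrow> 'a::euclidean_space"
  assumes f [measurable]: "f \<in> L \<rightarrow>\<^sub>M configs" and [measurable]: "g \<in> L \<rightarrow>\<^sub>M borel"
  shows "(\<lambda>z. insert (g z) (f z)) \<in> L \<rightarrow>\<^sub>M configs"
proof (rule measurable_configsI)
  have lf: "locally_finite (f z)" if "z \<in> space L" for z
    using measurable_space[OF f that] by (simp add: space_configs)
  then show "locally_finite (insert (g z) (f z))" if "z \<in> space L" for z
    using that by (auto simp: locally_finite_def Int_insert_left)
  fix A :: "'a set" assume A [measurable]: "A \<in> sets borel" and "bounded A"
  have [measurable]: "(\<lambda>z. card (f z \<inter> A)) \<in> L \<rightarrow>\<^sub>M count_space UNIV"
    using measurable_compose[OF f measurable_card_configs[OF A \<open>bounded A\<close>]] .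
  have "(\<lambda>z. card (f z \<inter> A) + (if g z \<in> A \<and> g z \<notin> f z then 1 else 0)) \<in> L \<rightarrow>\<^sub>M count_space UNIV"
    by measurable
  moreover have "card (insert (g z) (f z) \<inter> A) = card (f z \<inter> A) + (if g z \<in> A \<and> g z \<notin> f z then 1 else 0)"
    if "z \<in> space L" for z
    using locally_finite_Int[OF lf[OF that] \<open>bounded A\<close>] by (auto simp: Int_insert_left insert_absorb)
  ultimately show "(\<lambda>z. card (insert (g z) (f z) \<inter> A)) \<in> L \<rightarrow>\<^sub>M count_space UNIV"
    by (simp cong: measurable_cong)
qed

lemma mem_translate_config: "y \<in> translate_config \<omega> x \<longleftrightarrow> y + x \<in> \<omega>"
  unfolding translate_config_def by (metis (no_types, lifting) add_diff_cancel diff_add_cancel image_iff)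

lemma bij_betw_translate_config: "bij_betw (\<lambda>y. y - x) \<omega> (translate_config \<omega> x)"
  by (auto simp: bij_betw_def translate_config_def)

lemma translate_config_translate_config:
  "translate_config (translate_config \<omega> x) y = translate_config \<omega> (x + y)"
  by (auto simp: mem_translate_config algebra_simps)

lemma translate_config_0 [simp]: "translate_config \<omega> 0 = \<omega>"
  by (auto simp: mem_translate_config)

lemma card_translate_config: "card (translate_config \<omega> x \<inter> A) = card (\<omega> \<inter> {s. s - x \<in> A})"
proof -
  have "translate_config \<omega> x \<inter> A = (\<lambda>s. s - x) ` (\<omega> \<inter> {s. s - x \<in> A})"
    by (auto simp: translate_config_def)
  then show ?thesis by (simp add: card_image)
qed

lemma locally_finite_translate:
  fixes \<omega> :: "'a::real_normed_vector set"
  assumes "locally_finite \<omega>"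
  shows "locally_finite (translate_config \<omega> x)"
  unfolding locally_finite_def
proof (intro allI impI)
  fix A :: "'a set" assume A: "bounded A"
  have "translate_config \<omega> x \<inter> A \<subseteq> (\<lambda>s. s - x) ` (\<omega> \<inter> (\<lambda>a. a + x) ` A)"
  proof
    fix y assume "y \<in> translate_config \<omega> x \<inter> A"
    then have "y + x \<in> \<omega> \<inter> (\<lambda>a. a + x) ` A" by (simp add: mem_translate_config)
    then show "y \<in> (\<lambda>s. s - x) ` (\<omega> \<inter> (\<lambda>a. a + x) ` A)" by (rule rev_image_eqI) simp
  qed
  moreover have "bounded ((\<lambda>a. a + x) ` A)" using bounded_translation[OF A, of x] by (simp add: add.commute)
  then have "finite (\<omega> \<inter> (\<lambda>a. a + x) ` A)" using assms by (rule locally_finite_Int[rotated])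
  ultimately show "finite (translate_config \<omega> x \<inter> A)" using finite_subset by blast
qed

lemma measurable_translate_config [measurable (raw)]:
  fixes g :: "'b \<Rightarrow> 'a::euclidean_space"
  assumes f [measurable]: "f \<in> L \<rightarrow>\<^sub>M configs" and g [measurable]: "g \<in> L \<rightarrow>\<^sub>M borel"
  shows "(\<lambda>z. translate_config (f z) (g z)) \<in> L \<rightarrow>\<^sub>M configs"
proof (rule measurable_configsI)
  have lf: "locally_finite (translate_config (f z) (g z))" if "z \<in> space L" for z
    using measurable_space[OF f that] by (simp add: space_configs locally_finite_translate)
  then show "locally_finite (translate_config (f z) (g z))" if "z \<in> space L" for z
    using that .
  fix A :: "'a set" assume A [measurable]: "A \<in> sets borel" and "bounded A"
  have "(\<lambda>z. \<integral>\<^sup>+y. indicator A (snd (z, y) - g (fst (z, y))) \<partial>count_space (f z)) \<in> borel_measurable L"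
    by (rule measurable_nn_integral_points[OF f, of "\<lambda>p. indicator A (snd p - g (fst p))"]) measurable
  moreover have "(\<integral>\<^sup>+y. indicator A (snd (z, y) - g (fst (z, y))) \<partial>count_space (f z)) =
     ennreal (real (card (translate_config (f z) (g z) \<inter> A)))" if "z \<in> space L" for z
  proof -
    have "(\<integral>\<^sup>+y. indicator A (snd (z, y) - g (fst (z, y))) \<partial>count_space (f z)) =
      (\<integral>\<^sup>+y. indicator A y \<partial>count_space (translate_config (f z) (g z)))"
      using nn_integral_bij_count_space[OF bij_betw_translate_config, where f = "indicator A"] by simp
    also have "\<dots> = emeasure (count_space (translate_config (f z) (g z))) (translate_config (f z) (g z) \<inter> A)"
      by (subst nn_integral_indicator[symmetric], simp, intro nn_integral_cong) (auto simp: indicator_def)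
    also have "\<dots> = ennreal (real (card (translate_config (f z) (g z) \<inter> A)))"
      using locally_finite_Int[OF lf[OF that] \<open>bounded A\<close>]
      by (subst emeasure_count_space_finite) (auto simp: ennreal_of_nat_eq_real_of_nat)
    finally show ?thesis .
  qed
  ultimately have "(\<lambda>z. ennreal (real (card (translate_config (f z) (g z) \<inter> A)))) \<in> borel_measurable L"
    by (simp cong: measurable_cong)
  then have [measurable]: "(\<lambda>z. enn2real (ennreal (real (card (translate_config (f z) (g z) \<inter> A))))) \<in> borel_measurable L"
    by measurable
  have "(\<lambda>z. nat \<lfloor>enn2real (ennreal (real (card (translate_config (f z) (g z) \<inter> A))))\<rfloor>) \<in> L \<rightarrow>\<^sub>M count_space UNIV"
    by measurable
  then show "(\<lambda>z. card (translate_config (f z) (g z) \<inter> A)) \<in> L \<rightarrow>\<^sub>M count_space UNIV"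
    by simp
qed

section \<open>Laws of configurations are determined by counts in disjoint sets\<close>

abbreviation bounded_borel :: "'a::metric_space set \<Rightarrow> bool" where
  "bounded_borel A \<equiv> A \<in> sets borel \<and> bounded A"

text \<open>Independence in a Poisson process is stated for disjoint sets only. The atoms of the algebra
  generated by \<open>\<A>\<close>, without the one outside all of its members, express the counts in \<open>\<A>\<close> through
  counts in disjoint sets.\<close>

lemma disjoint_atoms:
  assumes "finite \<A>" "\<forall>A\<in>\<A>. bounded_borel A"
  shows "\<exists>m (C :: nat \<Rightarrow> 'a::metric_space set). (\<forall>i<m. bounded_borel (C i)) \<and> disjoint_family_on C {..<m} \<and>
    (\<forall>A\<in>\<A>. A \<subseteq> (\<Union>i<m. C i) \<and> (\<forall>i<m. C i \<subseteq> A \<or> C i \<inter> A = {}))"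
proof -
  define atom where "atom J = {x. \<forall>A\<in>\<A>. x \<in> A \<longleftrightarrow> A \<in> J}" for J
  let ?P = "Pow \<A> - {{}}"
  have "finite ?P" using assms(1) by simp
  from ex_bij_betw_nat_finite[OF this] obtain h where h: "bij_betw h {0..<card ?P} ?P" by blast
  let ?m = "card ?P"
  have hP: "h i \<in> ?P" if "i < ?m" for i using bij_betwE[OF h] that by auto
  have box: "bounded_borel (atom (h i))" if i: "i < ?m" for i
  proof
    have "atom (h i) = (\<Inter>A\<in>\<A>. if A \<in> h i then A else - A)"
      by (auto simp: atom_def split: if_splits)
    also have "\<dots> \<in> sets borel"
      using assms hP[OF i] by (intro sets.finite_INT) (auto simp: borel_comp)
    finally show "atom (h i) \<in> sets borel" .
    from hP[OF i] have "h i \<noteq> {}" "h i \<subseteq> \<A>" by auto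
    then obtain A where A: "A \<in> h i" "A \<in> \<A>" by auto
    then have "atom (h i) \<subseteq> A" by (auto simp: atom_def)
    then show "bounded (atom (h i))" using bspec[OF assms(2) A(2)] bounded_subset by blast
  qed
  have disj: "disjoint_family_on (\<lambda>i. atom (h i)) {..<?m}"
  proof (unfold disjoint_family_on_def, intro ballI impI)
    fix i j assume ij: "i \<in> {..<?m}" "j \<in> {..<?m}" "i \<noteq> j"
    then have "h i \<noteq> h j" using inj_on_eq_iff[OF bij_betw_imp_inj_on[OF h], of i j] by auto
    moreover have "h i \<subseteq> \<A>" "h j \<subseteq> \<A>" using hP ij by auto
    ultimately show "atom (h i) \<inter> atom (h j) = {}" unfolding atom_def by blast
  qed
  have cover: "A \<subseteq> (\<Union>i<?m. atom (h i))" if "A \<in> \<A>" for A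
  proof
    fix x assume "x \<in> A"
    then have "{A \<in> \<A>. x \<in> A} \<in> ?P" using that by auto
    then have "{A \<in> \<A>. x \<in> A} \<in> h ` {0..<?m}" by (simp only: bij_betw_imp_surj_on[OF h])
    then obtain i where i: "i < ?m" "h i = {A \<in> \<A>. x \<in> A}" by auto
    then have "x \<in> atom (h i)" by (simp add: atom_def)
    with i(1) show "x \<in> (\<Union>i<?m. atom (h i))" by blast
  qed
  have "atom (h i) \<subseteq> A \<or> atom (h i) \<inter> A = {}" if "A \<in> \<A>" for i A
    using that by (auto simp: atom_def)
  with box disj cover show ?thesis by (intro exI[of _ ?m] exI[of _ "\<lambda>i. atom (h i)"]) blast
qed

lemma card_eq_sum_atoms:
  fixes \<omega> :: "'a::metric_space set" and C :: "nat \<Rightarrow> 'a set"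
  assumes \<omega>: "locally_finite \<omega>" and C: "\<And>i. i < m \<Longrightarrow> bounded (C i)" "disjoint_family_on C {..<m}"
    and A: "A \<subseteq> (\<Union>i<m. C i)" "\<And>i. i < m \<Longrightarrow> C i \<subseteq> A \<or> C i \<inter> A = {}"
  shows "card (\<omega> \<inter> A) = (\<Sum>i\<in>{i. i < m \<and> C i \<subseteq> A}. card (\<omega> \<inter> C i))"
proof -
  let ?I = "{i. i < m \<and> C i \<subseteq> A}"
  have "A = (\<Union>i\<in>?I. C i)"
  proof
    show "A \<subseteq> (\<Union>i\<in>?I. C i)"
    proof
      fix x assume "x \<in> A"
      with A(1) obtain i where "i < m" "x \<in> C i" by auto
      with A(2)[of i] \<open>x \<in> A\<close> show "x \<in> (\<Union>i\<in>?I. C i)" by auto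
    qed
  qed auto
  then have "\<omega> \<inter> A = (\<Union>i\<in>?I. \<omega> \<inter> C i)" by auto
  also have "card \<dots> = (\<Sum>i\<in>?I. card (\<omega> \<inter> C i))"
    using C locally_finite_Int[OF \<omega>]
    by (intro card_UN_disjoint finite_Collect_conjI) (auto simp: disjoint_family_on_def)
  finally show ?thesis .
qed

lemma sets_counts_configs:
  assumes "finite I" "\<And>i. i \<in> I \<Longrightarrow> bounded_borel (C i)"
  shows "{\<omega> \<in> space configs. \<forall>i\<in>I. card (\<omega> \<inter> C i) \<in> K i} \<in> sets configs"
proof -
  have "{\<omega> \<in> space configs. card (\<omega> \<inter> C i) \<in> K i} \<in> sets configs" if "i \<in> I" for i
    using sets_configs_count[of "C i" "K i"] assms(2)[OF that] by (simp add: space_configs)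
  with assms(1) show ?thesis by (intro sets.sets_Collect_finite_All) auto
qed

lemma sets_counts_eq_configs:
  fixes C :: "nat \<Rightarrow> 'a::metric_space set"
  assumes "\<And>i. i < m \<Longrightarrow> bounded_borel (C i)"
  shows "{\<omega> \<in> space configs. \<forall>i<m. card (\<omega> \<inter> C i) = k i} \<in> sets configs"
proof -
  have "{\<omega> \<in> space configs. \<forall>i\<in>{..<m}. card (\<omega> \<inter> C i) \<in> {k i}} \<in> sets configs"
    by (rule sets_counts_configs) (simp, rule assms, simp)
  then show ?thesis by (simp only: lessThan_iff Ball_def singleton_iff)
qed

text \<open>Events that prescribe finitely many counts are stable under intersection, and on the atoms of the
  sets involved both measures have the same countable joint law of counts. The given set \<open>B\<close> is made a
  union of atoms because in the Mecke formula one of the measures has the number of points in \<open>B\<close> as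
  density.\<close>

lemma configs_measure_eqI:
  fixes \<mu> \<nu> :: "'a::euclidean_space set measure"
  assumes \<mu>: "sets \<mu> = sets configs" and \<nu>: "sets \<nu> = sets configs" and B: "bounded_borel B"
    and fin: "emeasure \<mu> (space configs) \<noteq> \<infinity>"
    and eq: "\<And>m (C :: nat \<Rightarrow> 'a set) k. (\<And>i. i < m \<Longrightarrow> bounded_borel (C i)) \<Longrightarrow> disjoint_family_on C {..<m} \<Longrightarrow>
       B \<subseteq> (\<Union>i<m. C i) \<Longrightarrow> (\<And>i. i < m \<Longrightarrow> C i \<subseteq> B \<or> C i \<inter> B = {}) \<Longrightarrow>
       emeasure \<mu> {\<omega> \<in> space configs. \<forall>i<m. card (\<omega> \<inter> C i) = k i} =
       emeasure \<nu> {\<omega> \<in> space configs. \<forall>i<m. card (\<omega> \<inter> C i) = k i}"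
  shows "\<mu> = \<nu>"
proof -
  define cyl where "cyl F = {\<omega> \<in> space configs. \<forall>p\<in>F. card (\<omega> \<inter> fst p) \<in> snd p}"
    for F :: "('a set \<times> nat set) set"
  define G where "G = cyl ` {F. finite F \<and> (\<forall>p\<in>F. bounded_borel (fst p))}"
  have sets_cyl: "cyl F \<in> sets configs" if "finite F" "\<forall>p\<in>F. bounded_borel (fst p)" for F
    unfolding cyl_def using that by (intro sets_counts_configs) auto
  have sets_G: "sets configs = sigma_sets (space configs) G"
  proof
    have "sets configs = sigma_sets (space configs)
       {{\<omega> :: 'a set. locally_finite \<omega> \<and> card (\<omega> \<inter> A) \<in> K} | A K. A \<in> sets borel \<and> bounded A}"
      unfolding space_configs by (subst configs_def, rule sets_measure_of) auto
    also have "\<dots> \<subseteq> sigma_sets (space configs) G"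
    proof (rule sigma_sets_mono', safe)
      fix A :: "'a set" and K :: "nat set" assume "A \<in> sets borel" "bounded A"
      then have "cyl {(A, K)} \<in> G" by (auto simp: G_def)
      then show "{\<omega>. locally_finite \<omega> \<and> card (\<omega> \<inter> A) \<in> K} \<in> G" by (simp add: cyl_def space_configs)
    qed
    finally show "sets configs \<subseteq> sigma_sets (space configs) G" .
    show "sigma_sets (space configs) G \<subseteq> sets (configs :: 'a set measure)"
      using sets_cyl by (intro sets.sigma_sets_subset) (auto simp: G_def)
  qed
  show ?thesis
  proof (rule measure_eqI_generator_eq[where E = G and \<Omega> = "space configs" and A = "\<lambda>_. space configs"])
    show "Int_stable G"
    proof (rule Int_stableI)
      fix X Y assume "X \<in> G" "Y \<in> G"
      then obtain F F' where "X = cyl F" "Y = cyl F'" "finite F" "\<forall>p\<in>F. bounded_borel (fst p)"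
        "finite F'" "\<forall>p\<in>F'. bounded_borel (fst p)" by (auto simp: G_def)
      moreover from this have "X \<inter> Y = cyl (F \<union> F')" by (auto simp: cyl_def)
      ultimately show "X \<inter> Y \<in> G" unfolding G_def by (intro image_eqI[of _ _ "F \<union> F'"]) auto
    qed
    show "G \<subseteq> Pow (space configs)" by (auto simp: G_def cyl_def)
    show "sets \<mu> = sigma_sets (space configs) G" "sets \<nu> = sigma_sets (space configs) G"
      using \<mu> \<nu> sets_G by auto
    have "space configs = cyl {}" by (simp add: cyl_def)
    then show "range (\<lambda>_. space configs) \<subseteq> G" by (auto simp: G_def)
    show "emeasure \<mu> (space configs) \<noteq> \<infinity>" by (rule fin)
  next
    fix X assume "X \<in> G"
    then obtain F where X: "X = cyl F" and F: "finite F" "\<forall>p\<in>F. bounded_borel (fst p)"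
      by (auto simp: G_def)
    have fin_F: "finite (insert B (fst ` F))" and box_F: "\<forall>A\<in>insert B (fst ` F). bounded_borel A"
      using F B by auto
    from disjoint_atoms[OF fin_F box_F] obtain m and C :: "nat \<Rightarrow> 'a set" where
      C_box: "\<forall>i<m. bounded_borel (C i)" and C_disj: "disjoint_family_on C {..<m}" and
      C_split: "\<forall>A\<in>insert B (fst ` F). A \<subseteq> (\<Union>i<m. C i) \<and> (\<forall>i<m. C i \<subseteq> A \<or> C i \<inter> A = {})"
      by (elim exE conjE)
    have C: "\<And>i. i < m \<Longrightarrow> bounded_borel (C i)" "disjoint_family_on C {..<m}"
      "\<And>A. A \<in> insert B (fst ` F) \<Longrightarrow> A \<subseteq> (\<Union>i<m. C i)"
      "\<And>A i. A \<in> insert B (fst ` F) \<Longrightarrow> i < m \<Longrightarrow> C i \<subseteq> A \<or> C i \<inter> A = {}"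
      using C_box C_disj C_split by blast+
    let ?Y = "{..<m} \<rightarrow>\<^sub>E (UNIV :: nat set)"
    \<comment> \<open>The vector of counts of the atoms takes countably many values, so its law is determined by singletons.\<close>
    define v where "v \<omega> = (\<lambda>i\<in>{..<m}. card (\<omega> \<inter> C i))" for \<omega>
    have Y: "countable ?Y" by (intro countable_PiE) auto
    have pre: "v -` {a} \<inter> space configs = {\<omega> \<in> space configs. \<forall>i<m. card (\<omega> \<inter> C i) = a i}"
      if "a \<in> ?Y" for a
      using that by (auto simp: v_def fun_eq_iff PiE_iff extensional_def restrict_def)
    have meas: "v \<in> configs \<rightarrow>\<^sub>M count_space ?Y"
      unfolding measurable_count_space_eq_countable[OF Y]
    proof (intro conjI ballI)
      show "v \<in> space configs \<rightarrow> ?Y" by (simp add: v_def)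
      show "v -` {a} \<inter> space configs \<in> sets configs" if "a \<in> ?Y" for a
        unfolding pre[OF that] by (rule sets_counts_eq_configs) (rule C(1))
    qed
    have meas': "v \<in> \<mu> \<rightarrow>\<^sub>M count_space ?Y" "v \<in> \<nu> \<rightarrow>\<^sub>M count_space ?Y"
      using meas by (simp_all only: measurable_cong_sets[OF \<mu> refl] measurable_cong_sets[OF \<nu> refl])
    have sp: "space \<mu> = space configs" "space \<nu> = space configs"
      using sets_eq_imp_space_eq[OF \<mu>] sets_eq_imp_space_eq[OF \<nu>] .
    have eqd: "distr \<mu> (count_space ?Y) v = distr \<nu> (count_space ?Y) v"
    proof (rule measure_eqI_countable[OF _ _ Y])
      fix a assume a: "a \<in> ?Y"
      show "emeasure (distr \<mu> (count_space ?Y) v) {a} = emeasure (distr \<nu> (count_space ?Y) v) {a}"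
      proof -
        have "emeasure \<mu> {\<omega> \<in> space configs. \<forall>i<m. card (\<omega> \<inter> C i) = a i} =
            emeasure \<nu> {\<omega> \<in> space configs. \<forall>i<m. card (\<omega> \<inter> C i) = a i}"
          by (rule eq) (simp_all add: C)
        then show ?thesis
          using a by (simp only: emeasure_distr[OF meas'(1)] emeasure_distr[OF meas'(2)] sp pre[OF a]
            sets_count_space Pow_iff empty_subsetI insert_subset simp_thms)
      qed
    qed simp_all
    define R where "R = {a \<in> ?Y. \<forall>p\<in>F. (\<Sum>i\<in>{i. i < m \<and> C i \<subseteq> fst p}. a i) \<in> snd p}"
    have "X = v -` R \<inter> space configs"
    proof -
      have "card (\<omega> \<inter> fst p) = (\<Sum>i\<in>{i. i < m \<and> C i \<subseteq> fst p}. v \<omega> i)"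
        if "\<omega> \<in> space configs" "p \<in> F" for \<omega> p
      proof -
        have "card (\<omega> \<inter> fst p) = (\<Sum>i\<in>{i. i < m \<and> C i \<subseteq> fst p}. card (\<omega> \<inter> C i))"
          using that C by (intro card_eq_sum_atoms) (auto simp: space_configs)
        then show ?thesis by (simp add: v_def)
      qed
      moreover have "v \<omega> \<in> ?Y" for \<omega> by (auto simp: v_def)
      ultimately show ?thesis by (auto simp: X cyl_def R_def)
    qed
    moreover have "R \<in> sets (count_space ?Y)" by (auto simp: R_def)
    ultimately show "emeasure \<mu> X = emeasure \<nu> X"
      using emeasure_distr[OF meas'(1), of R] emeasure_distr[OF meas'(2), of R] eqd sp by simp
  qed auto
qed

section \<open>Poisson laws and the Mecke formula\<close>

lemma distr_lborel_uminus: "distr lborel borel uminus = (lborel :: 'a::euclidean_space measure)"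
  using lborel_affine[of "-1" "0 :: 'a"] by (simp add: density_1)

lemma measure_lborel_translation:
  assumes "A \<in> sets borel"
  shows "measure lborel ((+) x ` A) = measure lborel (A :: 'a::euclidean_space set)"
proof -
  have "(+) (- x) -` A = (+) x ` A"
    by (auto simp: image_iff algebra_simps intro!: bexI[of _ "_ - x"])
  then show ?thesis
    using measure_distr[of "(+) (- x)" lborel borel A] assms by (simp add: lborel_distr_plus)
qed

text \<open>For \<open>a = 0\<close> this is the point mass at 0, as it must be for sets of volume 0.\<close>

definition poisson_weight :: "real \<Rightarrow> nat \<Rightarrow> real" where
  "poisson_weight a k = exp (- a) * a ^ k / fact k"

locale poisson_law = prob_space P for P :: "'a::euclidean_space set measure" +
  fixes lam :: real
  assumes sets_P [measurable_cong]: "sets P = sets configs"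
    and lam_pos: "0 < lam"
    and fidi: "\<And>m (C :: nat \<Rightarrow> 'a set) k. (\<And>i. i < m \<Longrightarrow> bounded_borel (C i)) \<Longrightarrow> disjoint_family_on C {..<m} \<Longrightarrow>
      prob {\<omega> \<in> space configs. \<forall>i<m. card (\<omega> \<inter> C i) = k i} =
      (\<Prod>i<m. poisson_weight (lam * measure lborel (C i)) (k i))"

lemma poisson_law_distr:
  fixes S :: "'p \<Rightarrow> 'a::euclidean_space set"
  assumes "homogeneous_poisson_process M S lam"
  shows "poisson_law (distr M configs S) lam"
proof -
  interpret M: prob_space M using assms by (simp add: homogeneous_poisson_process_def)
  have S [measurable]: "S \<in> M \<rightarrow>\<^sub>M configs" using assms by (simp add: homogeneous_poisson_process_def)
  interpret D: prob_space "distr M configs S" by (rule M.prob_space_distr) simp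
  show ?thesis
  proof
    show "0 < lam" using assms by (simp add: homogeneous_poisson_process_def)
    fix m and C :: "nat \<Rightarrow> 'a set" and k :: "nat \<Rightarrow> nat"
    assume C: "\<And>i. i < m \<Longrightarrow> bounded_borel (C i)" "disjoint_family_on C {..<m}"
    let ?X = "\<lambda>i x. card (S x \<inter> C i)"
    have ind: "M.indep_vars (\<lambda>_. count_space UNIV) ?X {..<m}"
      and one: "M.prob {x \<in> space M. ?X i x = j} = poisson_weight (lam * measure lborel (C i)) j"
        if "i < m" for i j
      using assms C unfolding homogeneous_poisson_process_def poisson_weight_def by (simp_all add: that)
    have "D.prob {\<omega> \<in> space configs. \<forall>i<m. card (\<omega> \<inter> C i) = k i} =
        M.prob {x \<in> space M. \<forall>i<m. ?X i x = k i}"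
    proof (subst measure_distr[OF S])
      show "{\<omega> \<in> space configs. \<forall>i<m. card (\<omega> \<inter> C i) = k i} \<in> sets configs"
        by (rule sets_counts_eq_configs) (rule C)
      show "M.prob (S -` {\<omega> \<in> space configs. \<forall>i<m. card (\<omega> \<inter> C i) = k i} \<inter> space M) =
        M.prob {x \<in> space M. \<forall>i<m. ?X i x = k i}"
        using measurable_space[OF S] by (intro arg_cong[where f = M.prob]) blast
    qed
    also have "\<dots> = (\<Prod>i<m. poisson_weight (lam * measure lborel (C i)) (k i))"
    proof (cases "m = 0")
      case False
      then have "{x \<in> space M. \<forall>i<m. ?X i x = k i} = (\<Inter>i\<in>{..<m}. ?X i -` {k i} \<inter> space M)" by auto
      also have "M.prob \<dots> = (\<Prod>i<m. M.prob (?X i -` {k i} \<inter> space M))"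
        using False ind[of 0] by (intro M.indep_varsD) auto
      also have "\<dots> = (\<Prod>i<m. M.prob {x \<in> space M. ?X i x = k i})"
        by (intro prod.cong arg_cong[where f = M.prob]) auto
      finally show ?thesis using one by simp
    qed (simp add: M.prob_space)
    finally show "D.prob {\<omega> \<in> space configs. \<forall>i<m. card (\<omega> \<inter> C i) = k i} =
        (\<Prod>i<m. poisson_weight (lam * measure lborel (C i)) (k i))" .
  qed simp
qed

context poisson_law
begin

lemma space_P: "space P = {\<omega>. locally_finite \<omega>}"
  using sets_eq_imp_space_eq[OF sets_P] by (simp add: space_configs)

lemma emeasure_counts:
  fixes C :: "nat \<Rightarrow> 'a set"
  assumes "\<And>i. i < m \<Longrightarrow> bounded_borel (C i)" "disjoint_family_on C {..<m}"
  shows "emeasure P {\<omega> \<in> space configs. \<forall>i<m. card (\<omega> \<inter> C i) = k i} =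
      ennreal (\<Prod>i<m. poisson_weight (lam * measure lborel (C i)) (k i))"
  using fidi[OF assms] by (simp add: emeasure_eq_measure)

text \<open>The finite-dimensional laws in \<open>fidi\<close> leave no freedom; stationarity follows because they only
  involve volumes.\<close>

lemma law_unique:
  assumes "poisson_law Q lam"
  shows "P = Q"
proof -
  interpret Q: poisson_law Q lam by fact
  show ?thesis
    by (rule configs_measure_eqI[where B = "{}"])
      (simp_all add: sets_P Q.sets_P emeasure_counts Q.emeasure_counts)
qed

lemma prob_count:
  assumes "bounded_borel A"
  shows "prob {\<omega> \<in> space configs. card (\<omega> \<inter> A) = k} = poisson_weight (lam * measure lborel A) k"
  using fidi[of 1 "\<lambda>_. A" "\<lambda>_. k"] assms by (simp add: disjoint_family_on_def)

lemma stationary: "distr P configs (\<lambda>\<omega>. translate_config \<omega> x) = P"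
proof -
  have [measurable]: "(\<lambda>\<omega>. translate_config \<omega> x) \<in> P \<rightarrow>\<^sub>M configs" by simp
  interpret D: prob_space "distr P configs (\<lambda>\<omega>. translate_config \<omega> x)"
    by (rule prob_space_distr) simp
  have "poisson_law (distr P configs (\<lambda>\<omega>. translate_config \<omega> x)) lam"
  proof
    fix m and C :: "nat \<Rightarrow> 'a set" and k :: "nat \<Rightarrow> nat"
    assume C: "\<And>i. i < m \<Longrightarrow> bounded_borel (C i)" "disjoint_family_on C {..<m}"
    let ?C = "\<lambda>i. {s. s - x \<in> C i}"
    have C'_eq: "?C i = (+) x ` C i" for i
      by (auto simp: image_iff algebra_simps intro!: bexI[of _ "_ - x"])
    have C': "bounded_borel (?C i)" if "i < m" for i
    proof
      show "?C i \<in> sets borel"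
        using C(1)[OF that] measurable_sets[of "\<lambda>s. s - x" borel borel "C i"] by (simp add: vimage_def)
      show "bounded (?C i)" unfolding C'_eq using C(1)[OF that] by (intro bounded_translation) auto
    qed
    have "D.prob {\<omega> \<in> space configs. \<forall>i<m. card (\<omega> \<inter> C i) = k i} =
        prob {\<omega> \<in> space configs. \<forall>i<m. card (\<omega> \<inter> ?C i) = k i}"
    proof (subst measure_distr)
      show "{\<omega> \<in> space configs. \<forall>i<m. card (\<omega> \<inter> C i) = k i} \<in> sets configs"
        by (rule sets_counts_eq_configs) (rule C)
      show "prob ((\<lambda>\<omega>. translate_config \<omega> x) -` {\<omega> \<in> space configs. \<forall>i<m. card (\<omega> \<inter> C i) = k i} \<inter> space P) =
        prob {\<omega> \<in> space configs. \<forall>i<m. card (\<omega> \<inter> ?C i) = k i}"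
        by (intro arg_cong[where f = prob] set_eqI)
          (auto simp: card_translate_config space_P space_configs locally_finite_translate)
    qed simp
    also have "\<dots> = (\<Prod>i<m. poisson_weight (lam * measure lborel (?C i)) (k i))"
      using C(2) by (intro fidi C') (auto simp: disjoint_family_on_def)
    also have "\<dots> = (\<Prod>i<m. poisson_weight (lam * measure lborel (C i)) (k i))"
      unfolding C'_eq using C(1) by (intro prod.cong refl) (simp add: measure_lborel_translation)
    finally show "D.prob {\<omega> \<in> space configs. \<forall>i<m. card (\<omega> \<inter> C i) = k i} =
        (\<Prod>i<m. poisson_weight (lam * measure lborel (C i)) (k i))" .
  qed (simp_all add: lam_pos)
  from law_unique[OF this] show ?thesis by simp
qed

lemma AE_not_mem: "AE \<omega> in P. x \<notin> \<omega>"
proof -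
  have "prob {\<omega> \<in> space configs. card (\<omega> \<inter> {x}) = 0} = 1"
    using prob_count[of "{x}" 0] by (simp add: poisson_weight_def)
  then have "AE \<omega> in P. \<omega> \<in> {\<omega> \<in> space configs. card (\<omega> \<inter> {x}) = 0}"
    by (rule AE_prob_1)
  then show ?thesis by eventually_elim auto
qed

end

text \<open>The identity \<open>k * p k = a * p (k - 1)\<close> of the Poisson weights is the Mecke formula for one set; in a
  product of weights it acts on one factor.\<close>

lemma poisson_weight_shift:
  fixes m :: nat
  assumes "i < m"
  shows "real (k i) * (\<Prod>j<m. poisson_weight (a j) (k j)) =
    (if k i = 0 then 0 else a i * (\<Prod>j<m. poisson_weight (a j) ((k(i := k i - 1)) j)))"
proof (cases "k i")
  case (Suc l)
  let ?r = "\<Prod>j\<in>{..<m} - {i}. poisson_weight (a j) (k j)"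
  have 1: "real (Suc l) * poisson_weight (a i) (Suc l) = a i * poisson_weight (a i) l"
    by (simp add: poisson_weight_def del: of_nat_Suc)
  have 2: "(\<Prod>j<m. poisson_weight (a j) (k j)) = poisson_weight (a i) (Suc l) * ?r"
    using assms Suc prod.remove[of "{..<m}" i "\<lambda>j. poisson_weight (a j) (k j)"] by simp
  have "(\<Prod>j\<in>{..<m} - {i}. poisson_weight (a j) ((k(i := l)) j)) = ?r"
    by (intro prod.cong) auto
  then have 3: "(\<Prod>j<m. poisson_weight (a j) ((k(i := l)) j)) = poisson_weight (a i) l * ?r"
    using assms prod.remove[of "{..<m}" i "\<lambda>j. poisson_weight (a j) ((k(i := l)) j)"] by simp
  have "real (Suc l) * (\<Prod>j<m. poisson_weight (a j) (k j)) =
      a i * (\<Prod>j<m. poisson_weight (a j) ((k(i := l)) j))"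
    unfolding 2 3 mult.assoc[symmetric] 1 ..
  then show ?thesis using Suc by simp
qed simp

context poisson_law
begin

sublocale P_lborel: pair_sigma_finite P "lborel :: 'a measure" ..

text \<open>A fixed point \<open>y\<close> is almost surely absent from \<open>\<omega>\<close>, so inserting it raises exactly the count of the
  set that contains it.\<close>

lemma nn_integral_insert:
  fixes C :: "nat \<Rightarrow> 'a set"
  assumes i: "i < m" and y: "y \<in> C i" and C: "\<And>j. j < m \<Longrightarrow> bounded_borel (C j)" "disjoint_family_on C {..<m}"
  shows "(\<integral>\<^sup>+\<omega>. indicator {\<omega> \<in> space configs. \<forall>j<m. card (\<omega> \<inter> C j) = k j} (insert y \<omega>) \<partial>P) =
    (if k i = 0 then 0 else
      ennreal (\<Prod>j<m. poisson_weight (lam * measure lborel (C j)) ((k(i := k i - 1)) j)))"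
proof -
  let ?E = "\<lambda>k. {\<omega> \<in> space configs. \<forall>j<m. card (\<omega> \<inter> C j) = k j}"
  have "AE \<omega> in P. indicator (?E k) (insert y \<omega>) =
      (if k i = 0 then 0 else indicator (?E (k(i := k i - 1))) \<omega> :: ennreal)"
    using AE_not_mem[of y] AE_space
  proof eventually_elim
    case (elim \<omega>)
    have lf: "locally_finite \<omega>" using elim(2) by (simp add: space_P)
    have count: "card (insert y \<omega> \<inter> C j) = card (\<omega> \<inter> C j) + (if j = i then 1 else 0)" if j: "j < m" for j
    proof (cases "j = i")
      case True
      have "finite (\<omega> \<inter> C i)" using lf C(1)[OF i] by (intro locally_finite_Int) auto
      with True y elim(1) show ?thesis by (simp add: Int_insert_left)
    next
      case False
      then have "y \<notin> C j" using C(2) i j y by (auto simp: disjoint_family_on_def)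
      with False show ?thesis by (simp add: Int_insert_left)
    qed
    have "(\<forall>j<m. card (insert y \<omega> \<inter> C j) = k j) \<longleftrightarrow>
       k i \<noteq> 0 \<and> (\<forall>j<m. card (\<omega> \<inter> C j) = (k(i := k i - 1)) j)"
    proof (intro iffI conjI allI impI)
      assume *: "\<forall>j<m. card (insert y \<omega> \<inter> C j) = k j"
      then show "k i \<noteq> 0" using i count[OF i] by auto
      show "card (\<omega> \<inter> C j) = (k(i := k i - 1)) j" if "j < m" for j
        using * count[OF that] that by (auto split: if_splits)
    next
      fix j assume "k i \<noteq> 0 \<and> (\<forall>j<m. card (\<omega> \<inter> C j) = (k(i := k i - 1)) j)" "j < m"
      then show "card (insert y \<omega> \<inter> C j) = k j" using count[of j] by (auto split: if_splits)
    qed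
    moreover have "locally_finite (insert y \<omega>)"
      using lf by (auto simp: locally_finite_def Int_insert_left)
    ultimately show ?case using lf by (auto simp: indicator_def space_configs)
  qed
  then have "(\<integral>\<^sup>+\<omega>. indicator (?E k) (insert y \<omega>) \<partial>P) =
      (\<integral>\<^sup>+\<omega>. (if k i = 0 then 0 else indicator (?E (k(i := k i - 1))) \<omega>) \<partial>P)"
    by (rule nn_integral_cong_AE)
  also have "\<dots> = (if k i = 0 then 0 else emeasure P (?E (k(i := k i - 1))))"
  proof -
    have "?E (k(i := k i - 1)) \<in> sets P" unfolding sets_P by (rule sets_counts_eq_configs) (rule C)
    moreover have "(\<integral>\<^sup>+\<omega>. (if b then 0 else indicator A \<omega>) \<partial>P) = (if b then 0 else emeasure P A)"
      if "A \<in> sets P" for b A using that by simp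
    ultimately show ?thesis by blast
  qed
  also have "emeasure P (?E (k(i := k i - 1))) =
      ennreal (\<Prod>j<m. poisson_weight (lam * measure lborel (C j)) ((k(i := k i - 1)) j))"
    by (rule emeasure_counts) (rule C, assumption, rule C)
  finally show ?thesis .
qed

text \<open>Both sides are finite measures in \<open>F\<close>. On an event that prescribes the counts of disjoint sets \<open>C i\<close>,
  each set \<open>C i\<close> inside \<open>B\<close> contributes \<open>k i\<close> times the probability to the left and its volume times
  \<open>lam\<close> times the probability with \<open>k i\<close> lowered by one to the right.\<close>

lemma mecke_count:
  assumes B: "bounded_borel B" and F [measurable]: "F \<in> sets configs"
  shows "(\<integral>\<^sup>+\<omega>. ennreal (real (card (\<omega> \<inter> B))) * indicator F \<omega> \<partial>P) =
    (\<integral>\<^sup>+y. ennreal lam * indicator B y * (\<integral>\<^sup>+\<omega>. indicator F (insert y \<omega>) \<partial>P) \<partial>lborel)"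
proof -
  have B' [measurable]: "B \<in> sets borel" using B by simp
  have [measurable]: "(\<lambda>\<omega>. card (\<omega> \<inter> B)) \<in> configs \<rightarrow>\<^sub>M count_space UNIV"
    using B by (intro measurable_card_configs) auto
  define \<mu> where "\<mu> = density P (\<lambda>\<omega>. ennreal (real (card (\<omega> \<inter> B))))"
  define \<nu> where "\<nu> = distr (density (P \<Otimes>\<^sub>M lborel) (\<lambda>p. ennreal lam * indicator B (snd p))) configs
    (\<lambda>p. insert (snd p) (fst p))"
  have \<mu>: "emeasure \<mu> F = (\<integral>\<^sup>+\<omega>. ennreal (real (card (\<omega> \<inter> B))) * indicator F \<omega> \<partial>P)"
    if [measurable]: "F \<in> sets configs" for F
    unfolding \<mu>_def by (subst emeasure_density) simp_all
  have \<nu>: "emeasure \<nu> F =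
      (\<integral>\<^sup>+y. ennreal lam * indicator B y * (\<integral>\<^sup>+\<omega>. indicator F (insert y \<omega>) \<partial>P) \<partial>lborel)"
    if [measurable]: "F \<in> sets configs" for F
  proof -
    have "emeasure \<nu> F = (\<integral>\<^sup>+\<omega>. indicator F \<omega> \<partial>\<nu>)" by (simp add: \<nu>_def)
    also have "\<dots> = (\<integral>\<^sup>+p. ennreal lam * indicator B (snd p) * indicator F (insert (snd p) (fst p)) \<partial>(P \<Otimes>\<^sub>M lborel))"
      unfolding \<nu>_def by (subst nn_integral_distr, simp, simp, subst nn_integral_density) simp_all
    also have "\<dots> = (\<integral>\<^sup>+y. \<integral>\<^sup>+\<omega>. ennreal lam * indicator B y * indicator F (insert y \<omega>) \<partial>P \<partial>lborel)"
      by (subst P_lborel.nn_integral_snd[symmetric]) simp_all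
    also have "\<dots> = (\<integral>\<^sup>+y. ennreal lam * indicator B y * (\<integral>\<^sup>+\<omega>. indicator F (insert y \<omega>) \<partial>P) \<partial>lborel)"
      by (intro nn_integral_cong nn_integral_cmult) simp
    finally show ?thesis .
  qed
  have "\<nu> = \<mu>"
  proof (rule configs_measure_eqI[OF _ _ B])
    have sp: "space configs \<in> sets (configs :: 'a set measure)" by simp
    have "emeasure \<nu> (space configs) \<le> (\<integral>\<^sup>+y. ennreal lam * indicator B y * 1 \<partial>lborel)"
      unfolding \<nu>[OF sp]
    proof (intro nn_integral_mono mult_left_mono)
      fix y :: 'a
      have "(\<integral>\<^sup>+\<omega>. indicator (space configs) (insert y \<omega>) \<partial>P) \<le> (\<integral>\<^sup>+\<omega>. 1 \<partial>P)"
        by (intro nn_integral_mono) (simp split: split_indicator)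
      then show "(\<integral>\<^sup>+\<omega>. indicator (space configs) (insert y \<omega>) \<partial>P) \<le> 1"
        by (simp add: emeasure_space_1)
    qed simp
    also have "\<dots> = ennreal lam * emeasure lborel B"
      by (simp add: nn_integral_cmult)
    also have "\<dots> < \<infinity>"
      using emeasure_bounded_finite[of B] B by (auto simp: ennreal_mult_less_top)
    finally show "emeasure \<nu> (space configs) \<noteq> \<infinity>" by simp
  next
    fix m k and C :: "nat \<Rightarrow> 'a set"
    assume C: "\<And>i. i < m \<Longrightarrow> bounded_borel (C i)" "disjoint_family_on C {..<m}"
      "B \<subseteq> (\<Union>i<m. C i)" "\<And>i. i < m \<Longrightarrow> C i \<subseteq> B \<or> C i \<inter> B = {}"
    let ?E = "{\<omega> \<in> space configs. \<forall>i<m. card (\<omega> \<inter> C i) = k i}"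
    let ?a = "\<lambda>i. lam * measure lborel (C i)"
    let ?p = "\<Prod>i<m. poisson_weight (?a i) (k i)"
    let ?q = "\<lambda>i. if k i = 0 then 0 else \<Prod>j<m. poisson_weight (?a j) ((k(i := k i - 1)) j)"
    define J where "J = {i. i < m \<and> C i \<subseteq> B}"
    have J: "finite J" "\<And>i. i \<in> J \<Longrightarrow> i < m" by (auto simp: J_def)
    have E [measurable]: "?E \<in> sets configs" by (rule sets_counts_eq_configs) (rule C)
    have Ep: "emeasure P ?E = ennreal ?p"
      by (rule emeasure_counts) (rule C, assumption, rule C)
    have nonneg: "0 \<le> poisson_weight (?a i) j" for i j
      using lam_pos by (simp add: poisson_weight_def)
    have "card (\<omega> \<inter> B) = (\<Sum>i\<in>J. k i)" if "\<omega> \<in> ?E" for \<omega>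
    proof -
      have "card (\<omega> \<inter> B) = (\<Sum>i\<in>J. card (\<omega> \<inter> C i))"
        unfolding J_def using that C by (intro card_eq_sum_atoms) (auto simp: space_configs)
      also have "\<dots> = (\<Sum>i\<in>J. k i)" using that J(2) by (intro sum.cong) auto
      finally show ?thesis .
    qed
    then have "emeasure \<mu> ?E = (\<integral>\<^sup>+\<omega>. ennreal (real (\<Sum>i\<in>J. k i)) * indicator ?E \<omega> \<partial>P)"
      unfolding \<mu>[OF E] by (intro nn_integral_cong) (simp split: split_indicator)
    also have "\<dots> = ennreal (real (\<Sum>i\<in>J. k i)) * ennreal ?p"
      by (subst nn_integral_cmult_indicator) (simp_all only: sets_P E Ep)
    also have "\<dots> = ennreal (\<Sum>i\<in>J. real (k i) * ?p)"
      by (simp add: ennreal_mult''[symmetric] prod_nonneg nonneg sum_distrib_right)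
    also have "\<dots> = ennreal (\<Sum>i\<in>J. ?a i * ?q i)"
      by (intro arg_cong[where f = ennreal] sum.cong refl, subst poisson_weight_shift)
        (rule J(2), assumption, simp)
    also have "\<dots> = (\<Sum>i\<in>J. ennreal (?a i * ?q i))"
      by (rule sum_ennreal[symmetric]) (use lam_pos in \<open>auto intro!: mult_nonneg_nonneg prod_nonneg nonneg\<close>)
    also have "\<dots> = (\<Sum>i\<in>J. \<integral>\<^sup>+y. ennreal lam * ennreal (?q i) * indicator (C i) y \<partial>lborel)"
    proof (intro sum.cong refl)
      fix i assume "i \<in> J"
      with J C(1) have Ci: "bounded_borel (C i)" by auto
      have "emeasure lborel (C i) = ennreal (measure lborel (C i))"
        using emeasure_bounded_finite[of "C i"] Ci by (intro emeasure_eq_ennreal_measure) auto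
      moreover have "0 \<le> ?q i" by (simp add: prod_nonneg nonneg)
      ultimately show "ennreal (?a i * ?q i) = (\<integral>\<^sup>+y. ennreal lam * ennreal (?q i) * indicator (C i) y \<partial>lborel)"
        using Ci lam_pos by (subst nn_integral_cmult_indicator) (auto simp: ennreal_mult ac_simps)
    qed
    also have "\<dots> = (\<integral>\<^sup>+y. (\<Sum>i\<in>J. ennreal lam * ennreal (?q i) * indicator (C i) y) \<partial>lborel)"
    proof (rule nn_integral_sum[symmetric])
      fix i assume "i \<in> J"
      then have [measurable]: "C i \<in> sets borel" using C(1) J(2) by blast
      show "(\<lambda>y. ennreal lam * ennreal (?q i) * indicator (C i) y) \<in> borel_measurable lborel"
        by (intro borel_measurable_times_ennreal borel_measurable_const) measurable
    qed
    also have "\<dots> = emeasure \<nu> ?E"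
      unfolding \<nu>[OF E]
    proof (intro nn_integral_cong)
      fix y :: 'a
      show "(\<Sum>i\<in>J. ennreal lam * ennreal (?q i) * indicator (C i) y) =
        ennreal lam * indicator B y * (\<integral>\<^sup>+\<omega>. indicator ?E (insert y \<omega>) \<partial>P)"
      proof (cases "y \<in> B")
        case True
        then obtain i where i: "i < m" "y \<in> C i" using C(3) by auto
        with True C(4)[of i] have "i \<in> J" by (auto simp: J_def)
        have "y \<notin> C j" if "j \<in> J - {i}" for j
          using that i J(2) C(2) by (auto simp: disjoint_family_on_def)
        then have "(\<Sum>j\<in>J. ennreal lam * ennreal (?q j) * indicator (C j) y) = ennreal lam * ennreal (?q i)"
          using i \<open>i \<in> J\<close> J(1) by (subst sum.remove[of J i]) (auto intro!: sum.neutral)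
        also have "ennreal (?q i) = (\<integral>\<^sup>+\<omega>. indicator ?E (insert y \<omega>) \<partial>P)"
          by (subst nn_integral_insert[OF i C(1,2)]) simp_all
        finally show ?thesis using True by simp
      next
        case False
        then show ?thesis by (auto simp: J_def intro!: sum.neutral)
      qed
    qed
    finally show "emeasure \<nu> ?E = emeasure \<mu> ?E" by simp
  qed (simp_all add: \<mu>_def \<nu>_def sets_P)
  then show ?thesis using \<mu>[OF F] \<nu>[OF F] by simp
qed

text \<open>The formula says that two measures on pairs of a configuration and a point coincide: the law of \<open>\<omega>\<close>
  with one of its points, and \<open>lam\<close> times Lebesgue measure for the point, with that point inserted into
  an independent configuration. On products of sets this is the previous lemma.\<close>

lemma mecke:
  assumes h [measurable]: "h \<in> borel_measurable (configs \<Otimes>\<^sub>M borel)"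
  shows "(\<integral>\<^sup>+\<omega>. \<integral>\<^sup>+y. h (\<omega>, y) \<partial>count_space \<omega> \<partial>P) =
    (\<integral>\<^sup>+y. ennreal lam * (\<integral>\<^sup>+\<omega>. h (insert y \<omega>, y) \<partial>P) \<partial>lborel)"
proof -
  let ?CB = "(configs :: 'a set measure) \<Otimes>\<^sub>M (borel :: 'a measure)"
  have lf: "locally_finite \<omega>" if "\<omega> \<in> space P" for \<omega> using that by (simp add: space_P)
  interpret N: sigma_finite_measure "count_space (UNIV :: nat set)"
    by (rule sigma_finite_measure_count_space_countable) simp
  \<comment> \<open>Every point of \<open>\<omega>\<close> is counted once, at the first cell that singles it out.\<close>
  define \<nu>1 where "\<nu>1 = distr (density (P \<Otimes>\<^sub>M count_space (UNIV :: nat set))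
    (\<lambda>p. if first_singled_out (snd p) (fst p) then 1 else 0)) ?CB (\<lambda>p. (fst p, point (snd p) (fst p)))"
  define \<nu>2 where "\<nu>2 = distr (density (P \<Otimes>\<^sub>M lborel) (\<lambda>_. ennreal lam)) ?CB (\<lambda>p. (insert (snd p) (fst p), snd p))"
  have [measurable]: "(\<lambda>p. point (snd p) (fst p)) \<in> P \<Otimes>\<^sub>M count_space UNIV \<rightarrow>\<^sub>M borel"
    by (rule measurable_compose_countable[of "\<lambda>k p. point k (fst p)" _ _ snd]) simp_all
  have [measurable]: "Measurable.pred (P \<Otimes>\<^sub>M count_space UNIV) (\<lambda>p. first_singled_out (snd p) (fst p))"
    by (rule measurable_compose_countable[of "\<lambda>k p. first_singled_out k (fst p)" _ _ snd]) simp_all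
  have I1: "(\<integral>\<^sup>+p. g p \<partial>\<nu>1) = (\<integral>\<^sup>+\<omega>. \<integral>\<^sup>+y. g (\<omega>, y) \<partial>count_space \<omega> \<partial>P)"
    if g [measurable]: "g \<in> borel_measurable ?CB" for g
  proof -
    have "(\<integral>\<^sup>+p. g p \<partial>\<nu>1) = (\<integral>\<^sup>+p. (if first_singled_out (snd p) (fst p) then 1 else 0) *
        g (fst p, point (snd p) (fst p)) \<partial>(P \<Otimes>\<^sub>M count_space UNIV))"
      unfolding \<nu>1_def by (subst nn_integral_distr, simp, simp, subst nn_integral_density) simp_all
    also have "\<dots> = (\<integral>\<^sup>+\<omega>. \<integral>\<^sup>+k. (if first_singled_out k \<omega> then 1 else 0) * g (\<omega>, point k \<omega>) \<partial>count_space UNIV \<partial>P)"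
      by (subst N.nn_integral_fst[symmetric]) simp_all
    also have "\<dots> = (\<integral>\<^sup>+\<omega>. \<integral>\<^sup>+y. g (\<omega>, y) \<partial>count_space \<omega> \<partial>P)"
      by (intro nn_integral_cong) (simp add: nn_integral_points lf indicator_def of_bool_def)
    finally show ?thesis .
  qed
  have I2: "(\<integral>\<^sup>+p. g p \<partial>\<nu>2) = (\<integral>\<^sup>+y. ennreal lam * (\<integral>\<^sup>+\<omega>. g (insert y \<omega>, y) \<partial>P) \<partial>lborel)"
    if g [measurable]: "g \<in> borel_measurable ?CB" for g
  proof -
    have "(\<integral>\<^sup>+p. g p \<partial>\<nu>2) = (\<integral>\<^sup>+p. ennreal lam * g (insert (snd p) (fst p), snd p) \<partial>(P \<Otimes>\<^sub>M lborel))"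
      unfolding \<nu>2_def by (subst nn_integral_distr, simp, simp, subst nn_integral_density) simp_all
    also have "\<dots> = (\<integral>\<^sup>+y. \<integral>\<^sup>+\<omega>. ennreal lam * g (insert y \<omega>, y) \<partial>P \<partial>lborel)"
      by (subst P_lborel.nn_integral_snd[symmetric]) simp_all
    also have "\<dots> = (\<integral>\<^sup>+y. ennreal lam * (\<integral>\<^sup>+\<omega>. g (insert y \<omega>, y) \<partial>P) \<partial>lborel)"
      by (intro nn_integral_cong nn_integral_cmult) simp
    finally show ?thesis .
  qed
  have sets_\<nu>: "sets \<nu>1 = sets ?CB" "sets \<nu>2 = sets ?CB" by (simp_all add: \<nu>1_def \<nu>2_def)
  have bounded_eq: "emeasure \<nu>1 (F \<times> B) = emeasure \<nu>2 (F \<times> B)"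
    if F [measurable]: "F \<in> sets configs" and B: "bounded_borel B" for F B
  proof -
    have [measurable]: "B \<in> sets borel" using B by simp
    have FB: "F \<times> B \<in> sets ?CB" by simp
    have "emeasure \<nu>1 (F \<times> B) = (\<integral>\<^sup>+\<omega>. \<integral>\<^sup>+y. indicator (F \<times> B) (\<omega>, y) \<partial>count_space \<omega> \<partial>P)"
      using FB by (subst I1[symmetric]) (simp_all add: sets_\<nu>)
    also have "\<dots> = (\<integral>\<^sup>+\<omega>. ennreal (real (card (\<omega> \<inter> B))) * indicator F \<omega> \<partial>P)"
    proof (rule nn_integral_cong)
      fix \<omega> assume "\<omega> \<in> space P"
      then have "finite (\<omega> \<inter> B)" using B by (simp add: lf locally_finite_Int)
      have "(\<integral>\<^sup>+y. indicator (F \<times> B) (\<omega>, y) \<partial>count_space \<omega>) = (\<integral>\<^sup>+y. indicator F \<omega> * indicator (\<omega> \<inter> B) y \<partial>count_space \<omega>)"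
        by (intro nn_integral_cong) (auto simp: indicator_def)
      also have "\<dots> = indicator F \<omega> * emeasure (count_space \<omega>) (\<omega> \<inter> B)"
        by (subst nn_integral_cmult_indicator) simp_all
      finally show "(\<integral>\<^sup>+y. indicator (F \<times> B) (\<omega>, y) \<partial>count_space \<omega>) = ennreal (real (card (\<omega> \<inter> B))) * indicator F \<omega>"
        using \<open>finite (\<omega> \<inter> B)\<close> by (simp add: ennreal_of_nat_eq_real_of_nat mult.commute)
    qed
    also have "\<dots> = (\<integral>\<^sup>+y. ennreal lam * indicator B y * (\<integral>\<^sup>+\<omega>. indicator F (insert y \<omega>) \<partial>P) \<partial>lborel)"
      by (rule mecke_count[OF B F])
    also have "\<dots> = (\<integral>\<^sup>+y. ennreal lam * (\<integral>\<^sup>+\<omega>. indicator (F \<times> B) (insert y \<omega>, y) \<partial>P) \<partial>lborel)"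
      by (intro nn_integral_cong) (simp add: indicator_times split: split_indicator)
    also have "\<dots> = emeasure \<nu>2 (F \<times> B)"
      using FB by (subst I2[symmetric]) (simp_all add: sets_\<nu>)
    finally show ?thesis .
  qed
  have "\<nu>1 = \<nu>2"
  proof (rule measure_eqI_generator_eq[OF Int_stable_pair_measure_generator[of configs borel],
        where \<Omega> = "space configs \<times> UNIV" and A = "\<lambda>n. space configs \<times> ball 0 (real n)"])
    show "{a \<times> b |a b. a \<in> sets configs \<and> b \<in> sets borel} \<subseteq> Pow (space configs \<times> (UNIV :: 'a set))"
      using sets.sets_into_space by fastforce
    show "sets \<nu>1 = sigma_sets (space configs \<times> UNIV) {a \<times> b |a b. a \<in> sets configs \<and> b \<in> sets borel}"
      "sets \<nu>2 = sigma_sets (space configs \<times> UNIV) {a \<times> b |a b. a \<in> sets configs \<and> b \<in> sets borel}"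
      unfolding sets_\<nu> sets_pair_measure by simp_all
    show "range (\<lambda>n. space configs \<times> ball 0 (real n)) \<subseteq> {a \<times> b |a b. a \<in> sets configs \<and> b \<in> sets (borel :: 'a measure)}"
      by (clarify, rule exI[of _ "space configs"], rule exI[of _ "ball 0 (real _)"]) simp
    show "(\<Union>n. space configs \<times> ball 0 (real n)) = space configs \<times> (UNIV :: 'a set)"
      by (auto simp: reals_Archimedean2)
  next
    fix n
    have "emeasure \<nu>1 (space configs \<times> ball 0 (real n)) = emeasure \<nu>2 (space configs \<times> ball 0 (real n))"
      by (rule bounded_eq) simp_all
    also have "\<dots> = (\<integral>\<^sup>+y. ennreal lam * (\<integral>\<^sup>+\<omega>. indicator (space configs \<times> ball 0 (real n)) (insert y \<omega>, y) \<partial>P) \<partial>lborel)"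
      by (subst I2[symmetric]) (simp_all add: sets_\<nu>)
    also have "\<dots> \<le> (\<integral>\<^sup>+y. ennreal lam * indicator (ball (0 :: 'a) (real n)) y \<partial>lborel)"
    proof (intro nn_integral_mono mult_left_mono)
      fix y :: 'a
      have "(\<integral>\<^sup>+\<omega>. indicator (space configs \<times> ball 0 (real n)) (insert y \<omega>, y) \<partial>P) \<le>
          (\<integral>\<^sup>+\<omega>. indicator (ball (0 :: 'a) (real n)) y \<partial>P)"
        by (intro nn_integral_mono) (simp split: split_indicator)
      then show "(\<integral>\<^sup>+\<omega>. indicator (space configs \<times> ball 0 (real n)) (insert y \<omega>, y) \<partial>P) \<le> indicator (ball 0 (real n)) y"
        by (simp add: emeasure_space_1)
    qed simp
    also have "\<dots> = ennreal lam * emeasure lborel (ball (0 :: 'a) (real n))"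
      by (subst nn_integral_cmult_indicator) simp_all
    also have "\<dots> < \<infinity>"
      using emeasure_bounded_finite[of "ball (0 :: 'a) (real n)"] by (auto simp: ennreal_mult_less_top)
    finally show "emeasure \<nu>1 (space configs \<times> ball 0 (real n)) \<noteq> \<infinity>" by simp
  next
    fix X :: "('a set \<times> 'a) set" assume "X \<in> {a \<times> b |a b. a \<in> sets configs \<and> b \<in> sets (borel :: 'a measure)}"
    then obtain F :: "'a set set" and B where X: "X = F \<times> B" and FB: "F \<in> sets configs" "B \<in> sets borel" by auto
    \<comment> \<open>The preceding comparison needs bounded sets, so \<open>B\<close> is exhausted by bounded pieces.\<close>
    let ?B = "\<lambda>n. F \<times> (B \<inter> ball 0 (real n))"
    have un: "(\<Union>n. ?B n) = X" by (auto simp: X reals_Archimedean2)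
    have inc: "incseq ?B" by (rule monoI) auto
    have box: "bounded_borel (B \<inter> ball 0 (real n))" for n using FB by (auto intro: bounded_Int)
    have sets_B: "?B n \<in> sets ?CB" for n using FB by auto
    have "emeasure \<nu>1 X = (SUP n. emeasure \<nu>1 (?B n))"
      unfolding un[symmetric] by (rule SUP_emeasure_incseq[symmetric]) (use sets_B inc in \<open>auto simp: sets_\<nu>\<close>)
    also have "\<dots> = (SUP n. emeasure \<nu>2 (?B n))" using bounded_eq[OF FB(1) box] by simp
    also have "\<dots> = emeasure \<nu>2 X"
      unfolding un[symmetric] by (rule SUP_emeasure_incseq) (use sets_B inc in \<open>auto simp: sets_\<nu>\<close>)
    finally show "emeasure \<nu>1 X = emeasure \<nu>2 X" .
  qed
  then show ?thesis using I1[OF h] I2[OF h] by simp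
qed

end

section \<open>Mass transport under the Palm law\<close>

lemma nn_integral_count_space_insert:
  assumes "x \<notin> A"
  shows "(\<integral>\<^sup>+y. f y \<partial>count_space (insert x A)) = f x + (\<integral>\<^sup>+y. f y \<partial>count_space A)"
proof -
  have "(\<integral>\<^sup>+y. f y \<partial>count_space (insert x A)) =
      (\<integral>\<^sup>+y. f y * indicator {x} y + f y * indicator A y \<partial>count_space UNIV)"
    using assms by (subst nn_integral_count_space_indicator) (auto intro!: nn_integral_cong simp: indicator_def)
  also have "\<dots> = (\<integral>\<^sup>+y. f y * indicator {x} y \<partial>count_space UNIV) + (\<integral>\<^sup>+y. f y * indicator A y \<partial>count_space UNIV)"
    by (rule nn_integral_add) simp_all
  also have "(\<integral>\<^sup>+y. f y * indicator {x} y \<partial>count_space UNIV) = f x"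
    by (simp add: nn_integral_count_space_indicator[symmetric] nn_integral_count_space_finite)
  finally show ?thesis by (simp add: nn_integral_count_space_indicator)
qed

context poisson_law
begin

definition palm :: "'a set measure" where
  "palm = distr P configs (insert 0)"

lemma sets_palm [measurable_cong, simp]: "sets palm = sets configs"
  and space_palm [simp]: "space palm = space configs"
  by (simp_all add: palm_def)

lemma prob_space_palm: "prob_space palm"
  unfolding palm_def by (rule prob_space_distr) simp

lemma AE_palm_0: "AE \<omega> in palm. 0 \<in> \<omega>"
  unfolding palm_def by (subst AE_distr_iff) (simp_all add: pred_def[symmetric])

text \<open>The point 0 contributes the first summand, the points of the Poisson process the second one, by
  the Mecke formula.\<close>

lemma nn_integral_palm:
  assumes g [measurable]: "g \<in> borel_measurable (configs \<Otimes>\<^sub>M borel)"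
  shows "(\<integral>\<^sup>+\<omega>. \<integral>\<^sup>+y. g (\<omega>, y) \<partial>count_space \<omega> \<partial>palm) =
    (\<integral>\<^sup>+\<omega>. g (insert 0 \<omega>, 0) \<partial>P) +
    (\<integral>\<^sup>+y. ennreal lam * (\<integral>\<^sup>+\<omega>. g (insert 0 (insert y \<omega>), y) \<partial>P) \<partial>lborel)"
proof -
  have [measurable]: "(\<lambda>\<omega>. \<integral>\<^sup>+y. g (\<omega>, y) \<partial>count_space \<omega>) \<in> borel_measurable configs"
    by (rule measurable_nn_integral_points[where f = "\<lambda>\<omega>. \<omega>"]) simp_all
  have m [measurable]: "(\<lambda>p. g (insert 0 (fst p), snd p)) \<in> borel_measurable (configs \<Otimes>\<^sub>M borel)"
    by simp
  have [measurable]: "(\<lambda>\<omega>. \<integral>\<^sup>+y. g (insert 0 \<omega>, y) \<partial>count_space \<omega>) \<in> borel_measurable configs"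
    using measurable_nn_integral_points[where f = "\<lambda>\<omega>. \<omega>", OF _ m] by simp
  have "(\<integral>\<^sup>+\<omega>. \<integral>\<^sup>+y. g (\<omega>, y) \<partial>count_space \<omega> \<partial>palm) =
      (\<integral>\<^sup>+\<omega>. \<integral>\<^sup>+y. g (insert 0 \<omega>, y) \<partial>count_space (insert 0 \<omega>) \<partial>P)"
    unfolding palm_def by (subst nn_integral_distr) simp_all
  also have "\<dots> = (\<integral>\<^sup>+\<omega>. g (insert 0 \<omega>, 0) + (\<integral>\<^sup>+y. g (insert 0 \<omega>, y) \<partial>count_space \<omega>) \<partial>P)"
    using AE_not_mem[of 0] by (intro nn_integral_cong_AE) (auto simp: nn_integral_count_space_insert)
  also have "\<dots> = (\<integral>\<^sup>+\<omega>. g (insert 0 \<omega>, 0) \<partial>P) + (\<integral>\<^sup>+\<omega>. \<integral>\<^sup>+y. g (insert 0 \<omega>, y) \<partial>count_space \<omega> \<partial>P)"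
    by (rule nn_integral_add) simp_all
  also have "(\<integral>\<^sup>+\<omega>. \<integral>\<^sup>+y. g (insert 0 \<omega>, y) \<partial>count_space \<omega> \<partial>P) =
      (\<integral>\<^sup>+y. ennreal lam * (\<integral>\<^sup>+\<omega>. g (insert 0 (insert y \<omega>), y) \<partial>P) \<partial>lborel)"
    using mecke[OF m] by simp
  finally show ?thesis .
qed

text \<open>The mass sent out by the origin equals on average the mass it receives. In the second summand of the
  preceding lemma, passing from \<open>(\<omega>, y)\<close> to \<open>(translate_config \<omega> y, - y)\<close> amounts to a translation of
  the Poisson process, which preserves its law, and to a reflection of Lebesgue measure.\<close>

lemma mass_transport:
  assumes g [measurable]: "g \<in> borel_measurable (configs \<Otimes>\<^sub>M borel)"
  shows "(\<integral>\<^sup>+\<omega>. \<integral>\<^sup>+y. g (\<omega>, y) \<partial>count_space \<omega> \<partial>palm) =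
    (\<integral>\<^sup>+\<omega>. \<integral>\<^sup>+y. g (translate_config \<omega> y, - y) \<partial>count_space \<omega> \<partial>palm)"
proof -
  let ?g' = "\<lambda>p. g (translate_config (fst p) (snd p), - snd p)"
  have m: "?g' \<in> borel_measurable (configs \<Otimes>\<^sub>M borel)" by simp
  have [measurable]: "(\<lambda>y. \<integral>\<^sup>+\<omega>. g (insert 0 (insert y \<omega>), y) \<partial>P) \<in> borel_measurable borel"
    by measurable
  have translate: "translate_config (insert 0 (insert y \<omega>)) y = insert 0 (insert (- y) (translate_config \<omega> y))"
    for y :: 'a and \<omega> by (auto simp: translate_config_def)
  have "(\<integral>\<^sup>+\<omega>. \<integral>\<^sup>+y. g (translate_config \<omega> y, - y) \<partial>count_space \<omega> \<partial>palm) =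
    (\<integral>\<^sup>+\<omega>. g (insert 0 \<omega>, 0) \<partial>P) +
    (\<integral>\<^sup>+y. ennreal lam * (\<integral>\<^sup>+\<omega>. g (insert 0 (insert (- y) (translate_config \<omega> y)), - y) \<partial>P) \<partial>lborel)"
    using nn_integral_palm[OF m] by (simp add: translate)
  also have "(\<lambda>y. \<integral>\<^sup>+\<omega>. g (insert 0 (insert (- y) (translate_config \<omega> y)), - y) \<partial>P) =
      (\<lambda>y. \<integral>\<^sup>+\<omega>. g (insert 0 (insert (- y) \<omega>), - y) \<partial>P)"
  proof
    fix y :: 'a
    have "(\<integral>\<^sup>+\<omega>. g (insert 0 (insert (- y) \<omega>), - y) \<partial>P) =
        (\<integral>\<^sup>+\<omega>. g (insert 0 (insert (- y) \<omega>), - y) \<partial>distr P configs (\<lambda>\<omega>. translate_config \<omega> y))"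
      by (simp add: stationary)
    also have "\<dots> = (\<integral>\<^sup>+\<omega>. g (insert 0 (insert (- y) (translate_config \<omega> y)), - y) \<partial>P)"
      by (subst nn_integral_distr) simp_all
    finally show "(\<integral>\<^sup>+\<omega>. g (insert 0 (insert (- y) (translate_config \<omega> y)), - y) \<partial>P) =
      (\<integral>\<^sup>+\<omega>. g (insert 0 (insert (- y) \<omega>), - y) \<partial>P)" by simp
  qed
  also have "(\<integral>\<^sup>+y. ennreal lam * (\<integral>\<^sup>+\<omega>. g (insert 0 (insert (- y) \<omega>), - y) \<partial>P) \<partial>lborel) =
      (\<integral>\<^sup>+y. ennreal lam * (\<integral>\<^sup>+\<omega>. g (insert 0 (insert y \<omega>), y) \<partial>P) \<partial>distr lborel borel uminus)"
    by (subst nn_integral_distr) simp_all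
  finally show ?thesis by (simp add: nn_integral_palm distr_lborel_uminus)
qed

text \<open>The Mecke formula for the event that \<open>\<omega>\<close> has \<open>k + 1\<close> points has a finite left side, while the right
  side is \<open>lam\<close> times the infinite volume of the space times the probability of \<open>k\<close> points.\<close>

lemma AE_infinite: "AE \<omega> in P. infinite \<omega>"
proof -
  define c where "c \<omega> = (\<integral>\<^sup>+y. 1 \<partial>count_space \<omega>)" for \<omega> :: "'a set"
  have c [measurable]: "c \<in> borel_measurable configs"
    unfolding c_def by (rule measurable_nn_integral_points[where f = "\<lambda>\<omega>. \<omega>" and h = "\<lambda>_. 1"]) simp_all
  have c_insert: "c (insert y \<omega>) = 1 + c \<omega>" if "y \<notin> \<omega>" for y \<omega>
    unfolding c_def using that by (rule nn_integral_count_space_insert)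
  have "AE \<omega> in P. c \<omega> \<noteq> of_nat k" for k
  proof -
    \<comment> \<open>For \<open>\<omega>\<close> with \<open>k + 1\<close> points, the sum of this indicator over the points is \<open>k + 1\<close>.\<close>
    let ?h = "\<lambda>p :: 'a set \<times> 'a. indicator {\<omega> \<in> space configs. c \<omega> = of_nat (Suc k)} (fst p) :: ennreal"
    have h: "?h \<in> borel_measurable (configs \<Otimes>\<^sub>M borel)" by measurable
    have "(\<integral>\<^sup>+y. ennreal lam * (\<integral>\<^sup>+\<omega>. ?h (insert y \<omega>, y) \<partial>P) \<partial>lborel) =
        (\<integral>\<^sup>+y. ennreal lam * emeasure P {\<omega> \<in> space P. c \<omega> = of_nat k} \<partial>(lborel :: 'a measure))"
    proof (intro nn_integral_cong arg_cong2[where f = "(*)"] refl)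
      fix y :: 'a
      have "(\<integral>\<^sup>+\<omega>. ?h (insert y \<omega>, y) \<partial>P) = (\<integral>\<^sup>+\<omega>. indicator {\<omega> \<in> space P. c \<omega> = of_nat k} \<omega> \<partial>P)"
      proof (rule nn_integral_cong_AE)
        show "AE \<omega> in P. ?h (insert y \<omega>, y) = indicator {\<omega> \<in> space P. c \<omega> = of_nat k} \<omega>"
          using AE_not_mem[of y] AE_space
        proof eventually_elim
          case (elim \<omega>)
          then have "insert y \<omega> \<in> space configs"
            by (auto simp: space_P space_configs locally_finite_def Int_insert_left)
          with elim show ?case by (auto simp: c_insert indicator_def)
        qed
      qed
      also have "\<dots> = emeasure P {\<omega> \<in> space P. c \<omega> = of_nat k}" by simp
      finally show "(\<integral>\<^sup>+\<omega>. ?h (insert y \<omega>, y) \<partial>P) = emeasure P {\<omega> \<in> space P. c \<omega> = of_nat k}" .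
    qed
    also have "\<dots> = ennreal lam * emeasure P {\<omega> \<in> space P. c \<omega> = of_nat k} * \<infinity>" by simp
    finally have rhs: "(\<integral>\<^sup>+\<omega>. \<integral>\<^sup>+y. ?h (\<omega>, y) \<partial>count_space \<omega> \<partial>P) = 
        ennreal lam * emeasure P {\<omega> \<in> space P. c \<omega> = of_nat k} * \<infinity>"
      using mecke[OF h] by simp
    have "(\<integral>\<^sup>+\<omega>. \<integral>\<^sup>+y. ?h (\<omega>, y) \<partial>count_space \<omega> \<partial>P) \<le> (\<integral>\<^sup>+\<omega>. of_nat (Suc k) \<partial>P)"
      by (intro nn_integral_mono) (auto simp: c_def split: split_indicator)
    also have "\<dots> < \<infinity>" by (simp add: emeasure_space_1 of_nat_less_top del: of_nat_Suc)
    finally have "emeasure P {\<omega> \<in> space P. c \<omega> = of_nat k} = 0"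
      unfolding rhs using lam_pos by (auto simp: ennreal_mult_less_top ennreal_mult_top split: if_splits)
    then show ?thesis by (subst AE_iff_measurable[OF _ refl]) simp_all
  qed
  then have "AE \<omega> in P. \<forall>k. c \<omega> \<noteq> of_nat k" by (simp add: AE_all_countable)
  then show ?thesis
    by eventually_elim (auto simp: c_def nn_integral_count_space_finite)
qed

lemma AE_palm_infinite: "AE \<omega> in palm. infinite \<omega>"
proof -
  have [measurable]: "(\<lambda>\<omega> :: 'a set. \<integral>\<^sup>+y. 1 \<partial>count_space \<omega>) \<in> borel_measurable configs"
    by (rule measurable_nn_integral_points[where f = "\<lambda>\<omega>. \<omega>" and h = "\<lambda>_. 1"]) simp_all
  have inf: "infinite \<omega> \<longleftrightarrow> (\<integral>\<^sup>+y. 1 \<partial>count_space \<omega>) = \<infinity>" for \<omega> :: "'a set"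
    by (cases "finite \<omega>") simp_all
  have "Measurable.pred configs (\<lambda>\<omega> :: 'a set. infinite \<omega>)"
    unfolding inf by measurable
  then have [measurable]: "{\<omega> \<in> space configs. infinite (\<omega> :: 'a set)} \<in> sets configs"
    by (simp add: pred_def)
  show ?thesis
    unfolding palm_def by (subst AE_distr_iff) (use AE_infinite in simp_all)
qed

end

section \<open>Layers of a configuration\<close>

text \<open>The cell that contains the difference vector colours the edge. Asking the cell to single out \<open>y\<close> as
  seen from \<open>x\<close>, and \<open>x\<close> as seen from \<open>y\<close>, makes every colour class a matching; since a configuration
  is locally finite, small cells do so for every edge. An edge may have several colours.\<close>

definition edges :: "'a::euclidean_space set \<Rightarrow> nat \<Rightarrow> 'a rel" where
  "edges \<omega> k = {(x, y). x \<in> \<omega> \<and> y \<in> \<omega> \<and> y - x \<in> cell k \<and>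
     (\<forall>z\<in>\<omega>. z - x \<in> cell k \<longrightarrow> z = y) \<and> (\<forall>z\<in>\<omega>. y - z \<in> cell k \<longrightarrow> z = x)}"

definition config_layer :: "nat \<Rightarrow> 'a::euclidean_space set \<Rightarrow> 'a rel" where
  "config_layer n \<omega> = layer (edges \<omega>) n"

lemma matching_edges: "matching (edges \<omega> k)"
  unfolding matching_def single_valued_def edges_def by blast

lemma edges_subset: "edges \<omega> k \<subseteq> \<omega> \<times> \<omega>"
  by (auto simp: edges_def)

lemma edges_0: "edges \<omega> 0 = Id_on \<omega>"
  by (auto simp: edges_def cell_0)

lemma edges_cover:
  assumes "locally_finite \<omega>"
  shows "\<omega> \<times> \<omega> \<subseteq> (\<Union>k. edges \<omega> k)"
proof safe
  fix x y assume xy: "x \<in> \<omega>" "y \<in> \<omega>"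
  obtain r where r: "0 < r" "\<omega> \<inter> ball x r \<subseteq> {x}" by (rule isolating_ball[OF assms])
  obtain s where s: "0 < s" "\<omega> \<inter> ball y s \<subseteq> {y}" by (rule isolating_ball[OF assms])
  obtain k where k: "y - x \<in> cell k" "cell k \<subseteq> ball (y - x) (min r s)"
    using small_cell[of "min r s" "y - x"] r s by auto
  have 1: "z = y" if "z \<in> \<omega>" "z - x \<in> cell k" for z
  proof -
    have "dist (y - x) (z - x) < s" using k(2) that(2) by auto
    then have "z \<in> \<omega> \<inter> ball y s" using that(1) by (simp add: dist_norm)
    then show ?thesis using s(2) by blast
  qed
  have 2: "z = x" if "z \<in> \<omega>" "y - z \<in> cell k" for z
  proof -
    have "dist (y - x) (y - z) < r" using k(2) that(2) by auto
    then have "z \<in> \<omega> \<inter> ball x r" using that(1) by (simp add: dist_norm norm_minus_commute)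
    then show ?thesis using r(2) by blast
  qed
  have "(x, y) \<in> edges \<omega> k" unfolding edges_def using xy k(1) 1 2 by blast
  then show "(x, y) \<in> (\<Union>k. edges \<omega> k)" by blast
qed

lemma edges_translate: "edges \<omega> = (\<lambda>k. inv_image (edges (translate_config \<omega> z) k) (\<lambda>x. x - z))"
proof
  fix k
  have ball: "(\<forall>w\<in>translate_config \<omega> z. Q w) \<longleftrightarrow> (\<forall>w\<in>\<omega>. Q (w - z))" for Q
    by (simp add: translate_config_def)
  show "edges \<omega> k = inv_image (edges (translate_config \<omega> z) k) (\<lambda>x. x - z)"
    by (auto simp: edges_def inv_image_def ball mem_translate_config)
qed

lemma config_layer_translate:
  "(x, y) \<in> config_layer n (translate_config \<omega> z) \<longleftrightarrow> (x + z, y + z) \<in> config_layer n \<omega>"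
proof -
  have "surj (\<lambda>x :: 'a. x - z)" by (metis add_diff_cancel surjI)
  from layer_inv_image[OF this, of "edges (translate_config \<omega> z)" n]
  have "config_layer n \<omega> = inv_image (config_layer n (translate_config \<omega> z)) (\<lambda>x. x - z)"
    unfolding config_layer_def by (subst edges_translate[of \<omega> z])
  then show ?thesis by (simp add: in_inv_image)
qed

lemma Domain_config_layer_translate:
  "x \<in> Domain (config_layer n (translate_config \<omega> z)) \<longleftrightarrow> x + z \<in> Domain (config_layer n \<omega>)"
  unfolding Domain_iff config_layer_translate by (metis diff_add_cancel)

lemma Range_config_layer_translate:
  "x \<in> Range (config_layer n (translate_config \<omega> z)) \<longleftrightarrow> x + z \<in> Range (config_layer n \<omega>)"
  unfolding Range_iff config_layer_translate by (metis diff_add_cancel)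

lemma config_layer_subset: "config_layer n \<omega> \<subseteq> \<omega> \<times> \<omega>"
  unfolding config_layer_def by (rule layer_subset) (rule edges_subset)

lemma matching_config_layer: "matching (config_layer n \<omega>)"
  unfolding config_layer_def by (rule matching_layer) (rule matching_edges)

lemma config_layer_unique:
  "(x, y) \<in> config_layer n \<omega> \<Longrightarrow> (x, y') \<in> config_layer n \<omega> \<Longrightarrow> y = y'"
  "(x, y) \<in> config_layer n \<omega> \<Longrightarrow> (x', y) \<in> config_layer n \<omega> \<Longrightarrow> x = x'"
  using matchingD[OF matching_config_layer] by blast+

lemma config_layer_0: "config_layer 0 \<omega> = Id_on \<omega>"
  unfolding config_layer_def by (rule layer_0) (rule edges_0, rule edges_subset)

text \<open>A single product space serves as the domain because the induction along the greedy construction needs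
  a fixed space, whereas quantifying over a further point enlarges it.\<close>

definition measurable_rel :: "('a::euclidean_space set \<Rightarrow> 'a rel) \<Rightarrow> bool" where
  "measurable_rel R \<longleftrightarrow> Measurable.pred (configs \<Otimes>\<^sub>M (borel \<Otimes>\<^sub>M borel)) (\<lambda>p. snd p \<in> R (fst p))"

lemma measurable_relD:
  assumes "measurable_rel R" "f \<in> L \<rightarrow>\<^sub>M configs" "g \<in> L \<rightarrow>\<^sub>M borel" "g' \<in> L \<rightarrow>\<^sub>M borel"
  shows "Measurable.pred L (\<lambda>z. (g z, g' z) \<in> R (f z))"
  using measurable_compose[of "\<lambda>z. (f z, g z, g' z)" L _ "\<lambda>p. snd p \<in> R (fst p)"] assms
  by (simp add: measurable_rel_def)

lemma measurable_rel_Domain_Range: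
  fixes R :: "'a::euclidean_space set \<Rightarrow> 'a rel" and f :: "'b \<Rightarrow> 'a set"
  assumes R: "measurable_rel R" "\<And>\<omega>. R \<omega> \<subseteq> \<omega> \<times> \<omega>"
    and [measurable]: "f \<in> L \<rightarrow>\<^sub>M configs" "g \<in> L \<rightarrow>\<^sub>M borel"
  shows "Measurable.pred L (\<lambda>z. g z \<in> Domain (R (f z)))"
    and "Measurable.pred L (\<lambda>z. g z \<in> Range (R (f z)))"
proof -
  note [measurable] = measurable_relD[OF R(1)]
  have "g z \<in> Domain (R (f z)) \<longleftrightarrow> (\<exists>y\<in>f z. (g z, y) \<in> R (f z))"
    "g z \<in> Range (R (f z)) \<longleftrightarrow> (\<exists>y\<in>f z. (y, g z) \<in> R (f z))" for z
    using R(2)[of "f z"] by (auto simp: Domain_iff Range_iff)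
  moreover have "Measurable.pred L (\<lambda>z. \<exists>y\<in>f z. (g z, y) \<in> R (f z))"
    by (rule pred_bex_points) (simp_all add: split_beta)
  moreover have "Measurable.pred L (\<lambda>z. \<exists>y\<in>f z. (y, g z) \<in> R (f z))"
    by (rule pred_bex_points) (simp_all add: split_beta)
  ultimately show "Measurable.pred L (\<lambda>z. g z \<in> Domain (R (f z)))"
    and "Measurable.pred L (\<lambda>z. g z \<in> Range (R (f z)))" by simp_all
qed

lemma measurable_rel_edges: "measurable_rel (\<lambda>\<omega>. edges \<omega> k)"
proof -
  let ?L = "configs \<Otimes>\<^sub>M (borel \<Otimes>\<^sub>M borel) :: ('a set \<times> 'a \<times> 'a) measure"
  have 1: "Measurable.pred ?L (\<lambda>p. \<forall>z\<in>fst p. z - fst (snd p) \<in> cell k \<longrightarrow> z = snd (snd p))"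
    by (rule pred_ball_points) (simp_all add: split_beta)
  have 2: "Measurable.pred ?L (\<lambda>p. \<forall>z\<in>fst p. snd (snd p) - z \<in> cell k \<longrightarrow> z = fst (snd p))"
    by (rule pred_ball_points) (simp_all add: split_beta)
  have "Measurable.pred ?L (\<lambda>p. fst (snd p) \<in> fst p \<and> snd (snd p) \<in> fst p \<and>
      snd (snd p) - fst (snd p) \<in> cell k \<and>
      (\<forall>z\<in>fst p. z - fst (snd p) \<in> cell k \<longrightarrow> z = snd (snd p)) \<and>
      (\<forall>z\<in>fst p. snd (snd p) - z \<in> cell k \<longrightarrow> z = fst (snd p)))"
    using 1 2 by measurable
  then show ?thesis by (simp add: measurable_rel_def edges_def split_beta)
qed

lemma measurable_rel_greedy_upto:
  assumes W: "measurable_rel W"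
  shows "measurable_rel (\<lambda>\<omega>. greedy_upto (edges \<omega>) (W \<omega>) k)"
proof (induction k)
  case 0
  then show ?case by (simp add: measurable_rel_def)
next
  case (Suc k)
  have sub: "greedy_upto (edges \<omega>) (W \<omega>) k \<subseteq> \<omega> \<times> \<omega>" for \<omega>
    using greedy_upto_subset[of "edges \<omega>" "W \<omega>" k] edges_subset[of \<omega>] by blast
  note [measurable] = measurable_relD[OF measurable_rel_edges] measurable_relD[OF W]
    measurable_relD[OF Suc] measurable_rel_Domain_Range[OF Suc sub]
  have "Measurable.pred (configs \<Otimes>\<^sub>M (borel \<Otimes>\<^sub>M borel))
    (\<lambda>p. (fst (snd p), snd (snd p)) \<in> greedy_upto (edges (fst p)) (W (fst p)) k \<or>
      (fst (snd p), snd (snd p)) \<in> edges (fst p) k \<and> (fst (snd p), snd (snd p)) \<notin> W (fst p) \<and>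
      fst (snd p) \<notin> Domain (greedy_upto (edges (fst p)) (W (fst p)) k) \<and>
      snd (snd p) \<notin> Range (greedy_upto (edges (fst p)) (W (fst p)) k))"
    by measurable
  then show ?case by (simp add: measurable_rel_def split_beta conj_assoc)
qed

lemma measurable_rel_UN:
  assumes "\<And>k :: nat. measurable_rel (R k)"
  shows "measurable_rel (\<lambda>\<omega>. \<Union>k. R k \<omega>)"
  using assms unfolding measurable_rel_def UN_iff by measurable

lemma measurable_rel_Un:
  assumes "measurable_rel R" "measurable_rel R'"
  shows "measurable_rel (\<lambda>\<omega>. R \<omega> \<union> R' \<omega>)"
  using assms unfolding measurable_rel_def Un_iff by measurable

lemma measurable_rel_used: "measurable_rel (\<lambda>\<omega>. used (edges \<omega>) n)"
proof (induction n)
  case 0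
  then show ?case by (simp add: measurable_rel_def)
next
  case (Suc n)
  then show ?case
    unfolding used.simps greedy_def
    by (intro measurable_rel_Un measurable_rel_UN measurable_rel_greedy_upto)
qed

lemma measurable_rel_config_layer: "measurable_rel (config_layer n)"
  unfolding config_layer_def[abs_def] layer_def greedy_def
  by (intro measurable_rel_UN measurable_rel_greedy_upto measurable_rel_used)

lemmas [measurable (raw)] = measurable_relD[OF measurable_rel_config_layer]
  measurable_rel_Domain_Range[OF measurable_rel_config_layer config_layer_subset]

section \<open>Layers are almost surely permutations\<close>

lemma nn_integral_matching_row:
  assumes "R \<subseteq> \<omega> \<times> \<omega>" "matching R"
  shows "(\<integral>\<^sup>+y. indicator {y. (x, y) \<in> R \<and> b} y \<partial>count_space \<omega>) = (if x \<in> Domain R \<and> b then 1 else 0)"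
    and "(\<integral>\<^sup>+y. indicator {y. (y, x) \<in> R \<and> b} y \<partial>count_space \<omega>) = (if x \<in> Range R \<and> b then 1 else 0)"
proof -
  have one: "(\<integral>\<^sup>+y. indicator Y y \<partial>count_space \<omega>) = (if Y = {} then 0 else 1 :: ennreal)"
    if sub: "Y \<subseteq> \<omega>" and uni: "\<And>y y'. y \<in> Y \<Longrightarrow> y' \<in> Y \<Longrightarrow> y = y'" for Y
  proof (cases "Y = {}")
    case False
    then obtain y where "Y = {y}" using uni by blast
    with sub show ?thesis by simp
  qed simp
  have "(\<integral>\<^sup>+y. indicator {y. (x, y) \<in> R \<and> b} y \<partial>count_space \<omega>) = (if {y. (x, y) \<in> R \<and> b} = {} then 0 else 1 :: ennreal)"
    by (rule one) (use assms(1) matchingD(1)[OF assms(2)] in blast)+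
  also have "{y. (x, y) \<in> R \<and> b} = {} \<longleftrightarrow> \<not> (x \<in> Domain R \<and> b)" by blast
  finally show "(\<integral>\<^sup>+y. indicator {y. (x, y) \<in> R \<and> b} y \<partial>count_space \<omega>) = (if x \<in> Domain R \<and> b then 1 else 0)"
    by simp
  have "(\<integral>\<^sup>+y. indicator {y. (y, x) \<in> R \<and> b} y \<partial>count_space \<omega>) = (if {y. (y, x) \<in> R \<and> b} = {} then 0 else 1 :: ennreal)"
    by (rule one) (use assms(1) matchingD(2)[OF assms(2)] in blast)+
  also have "{y. (y, x) \<in> R \<and> b} = {} \<longleftrightarrow> \<not> (x \<in> Range R \<and> b)" by blast
  finally show "(\<integral>\<^sup>+y. indicator {y. (y, x) \<in> R \<and> b} y \<partial>count_space \<omega>) = (if x \<in> Range R \<and> b then 1 else 0)"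
    by simp
qed

context poisson_law
begin

text \<open>Any point of the configuration is as good as the origin: let the origin send mass 1 to all points
  whenever \<open>T\<close> fails.\<close>

lemma AE_palm_all_points:
  assumes [measurable]: "Measurable.pred configs T" and T: "AE \<omega> in palm. T \<omega>"
  shows "AE \<omega> in palm. \<forall>y\<in>\<omega>. T (translate_config \<omega> y)"
proof -
  let ?g = "\<lambda>p :: 'a set \<times> 'a. if T (fst p) then 0 else 1 :: ennreal"
  have m: "(\<lambda>p. ?g (translate_config (fst p) (snd p), - snd p)) \<in> borel_measurable (configs \<Otimes>\<^sub>M borel)"
    by simp
  have F: "(\<lambda>\<omega>. \<integral>\<^sup>+y. ?g (translate_config \<omega> y, - y) \<partial>count_space \<omega>) \<in> borel_measurable palm"
    using measurable_nn_integral_points[where f = "\<lambda>\<omega>. \<omega>", OF _ m] by (simp cong: measurable_cong_sets)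
  have "(\<integral>\<^sup>+\<omega>. \<integral>\<^sup>+y. ?g (translate_config \<omega> y, - y) \<partial>count_space \<omega> \<partial>palm) =
      (\<integral>\<^sup>+\<omega>. \<integral>\<^sup>+y. ?g (\<omega>, y) \<partial>count_space \<omega> \<partial>palm)"
    by (rule mass_transport[symmetric]) simp
  also have "\<dots> = (\<integral>\<^sup>+\<omega>. 0 \<partial>palm)" using T by (intro nn_integral_cong_AE) auto
  finally have "(\<integral>\<^sup>+\<omega>. \<integral>\<^sup>+y. ?g (translate_config \<omega> y, - y) \<partial>count_space \<omega> \<partial>palm) = 0" by simp
  then have "AE \<omega> in palm. (\<integral>\<^sup>+y. ?g (translate_config \<omega> y, - y) \<partial>count_space \<omega>) = 0"
    unfolding nn_integral_0_iff_AE[OF F] .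
  then show ?thesis
    by eventually_elim (simp add: nn_integral_0_iff_AE AE_count_space split: if_splits)
qed

text \<open>If \<open>T\<close> holds, let the origin send mass 1 to all of the infinitely many points. It receives mass 1 from
  each of the at most \<open>n\<close> points from which \<open>T\<close> is seen to hold, so the mass sent has finite mean.\<close>

lemma AE_palm_not_few:
  assumes [measurable]: "Measurable.pred configs T"
    and few: "\<And>\<omega>. \<omega> \<in> space configs \<Longrightarrow>
      finite {y \<in> \<omega>. T (translate_config \<omega> y)} \<and> card {y \<in> \<omega>. T (translate_config \<omega> y)} \<le> n"
  shows "AE \<omega> in palm. \<not> T \<omega>"
proof -
  interpret palm: prob_space palm by (rule prob_space_palm)
  let ?g = "\<lambda>p :: 'a set \<times> 'a. if T (fst p) then 1 else 0 :: ennreal"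
  have "(\<integral>\<^sup>+\<omega>. (if T \<omega> then \<infinity> else 0) \<partial>palm) = (\<integral>\<^sup>+\<omega>. \<integral>\<^sup>+y. ?g (\<omega>, y) \<partial>count_space \<omega> \<partial>palm)"
    using AE_palm_infinite by (intro nn_integral_cong_AE) auto
  also have "\<dots> = (\<integral>\<^sup>+\<omega>. \<integral>\<^sup>+y. ?g (translate_config \<omega> y, - y) \<partial>count_space \<omega> \<partial>palm)"
    by (rule mass_transport) simp
  also have "\<dots> \<le> (\<integral>\<^sup>+\<omega>. of_nat n \<partial>palm)"
  proof (rule nn_integral_mono)
    fix \<omega> assume "\<omega> \<in> space palm"
    then have fin: "finite {y \<in> \<omega>. T (translate_config \<omega> y)}" "card {y \<in> \<omega>. T (translate_config \<omega> y)} \<le> n"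
      using few by auto
    have "(\<integral>\<^sup>+y. ?g (translate_config \<omega> y, - y) \<partial>count_space \<omega>) =
        (\<integral>\<^sup>+y. indicator {y \<in> \<omega>. T (translate_config \<omega> y)} y \<partial>count_space \<omega>)"
      by (intro nn_integral_cong) (auto simp: indicator_def)
    also have "\<dots> = of_nat (card {y \<in> \<omega>. T (translate_config \<omega> y)})"
      using fin(1) by (subst nn_integral_indicator) auto
    also have "\<dots> \<le> of_nat n" using fin(2) by simp
    finally show "(\<integral>\<^sup>+y. ?g (translate_config \<omega> y, - y) \<partial>count_space \<omega>) \<le> of_nat n" .
  qed
  also have "\<dots> < \<infinity>" using palm.emeasure_space_1 by (simp add: of_nat_less_top)
  finally have "(\<integral>\<^sup>+\<omega>. (if T \<omega> then \<infinity> else 0) \<partial>palm) \<noteq> \<infinity>" by simp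
  then have "AE \<omega> in palm. (if T \<omega> then \<infinity> else 0 :: ennreal) \<noteq> \<infinity>"
    by (intro nn_integral_PInf_AE) simp_all
  then show ?thesis by eventually_elim (simp split: if_splits)
qed

text \<open>Mass 1 travels along the edges of a layer; a translation-invariant event may be kept fixed.\<close>

lemma palm_Domain_eq_Range:
  assumes [measurable]: "Measurable.pred configs I"
    and inv: "\<And>\<omega> y. \<omega> \<in> space configs \<Longrightarrow> y \<in> \<omega> \<Longrightarrow> I (translate_config \<omega> y) = I \<omega>"
  shows "emeasure palm {\<omega> \<in> space palm. 0 \<in> Domain (config_layer n \<omega>) \<and> I \<omega>} =
    emeasure palm {\<omega> \<in> space palm. 0 \<in> Range (config_layer n \<omega>) \<and> I \<omega>}"
proof -
  let ?g = "\<lambda>p :: 'a set \<times> 'a. if (0, snd p) \<in> config_layer n (fst p) \<and> I (fst p) then 1 else 0 :: ennreal"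
  have [measurable]: "Measurable.pred configs (\<lambda>\<omega> :: 'a set. 0 \<in> Domain (config_layer n \<omega>))"
    "Measurable.pred configs (\<lambda>\<omega> :: 'a set. 0 \<in> Range (config_layer n \<omega>))"
    by measurable
  have "emeasure palm {\<omega> \<in> space palm. 0 \<in> Domain (config_layer n \<omega>) \<and> I \<omega>} =
      (\<integral>\<^sup>+\<omega>. indicator {\<omega> \<in> space palm. 0 \<in> Domain (config_layer n \<omega>) \<and> I \<omega>} \<omega> \<partial>palm)" by simp
  also have "\<dots> = (\<integral>\<^sup>+\<omega>. \<integral>\<^sup>+y. ?g (\<omega>, y) \<partial>count_space \<omega> \<partial>palm)"
  proof (rule nn_integral_cong)
    fix \<omega> assume "\<omega> \<in> space palm"
    moreover have "(\<integral>\<^sup>+y. ?g (\<omega>, y) \<partial>count_space \<omega>) =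
        (\<integral>\<^sup>+y. indicator {y. (0, y) \<in> config_layer n \<omega> \<and> I \<omega>} y \<partial>count_space \<omega>)"
      by (intro nn_integral_cong) (simp add: indicator_def)
    ultimately show "indicator {\<omega> \<in> space palm. 0 \<in> Domain (config_layer n \<omega>) \<and> I \<omega>} \<omega> =
        (\<integral>\<^sup>+y. ?g (\<omega>, y) \<partial>count_space \<omega>)"
      by (simp only: nn_integral_matching_row[OF config_layer_subset matching_config_layer])
        (simp add: indicator_def)
  qed
  also have "\<dots> = (\<integral>\<^sup>+\<omega>. \<integral>\<^sup>+y. ?g (translate_config \<omega> y, - y) \<partial>count_space \<omega> \<partial>palm)"
    by (rule mass_transport) simp
  also have "\<dots> = (\<integral>\<^sup>+\<omega>. indicator {\<omega> \<in> space palm. 0 \<in> Range (config_layer n \<omega>) \<and> I \<omega>} \<omega> \<partial>palm)"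
  proof (rule nn_integral_cong)
    fix \<omega> assume \<omega>: "\<omega> \<in> space palm"
    then have "(\<integral>\<^sup>+y. ?g (translate_config \<omega> y, - y) \<partial>count_space \<omega>) =
        (\<integral>\<^sup>+y. indicator {y. (y, 0) \<in> config_layer n \<omega> \<and> I \<omega>} y \<partial>count_space \<omega>)"
      by (intro nn_integral_cong) (simp add: indicator_def config_layer_translate inv)
    with \<omega> show "(\<integral>\<^sup>+y. ?g (translate_config \<omega> y, - y) \<partial>count_space \<omega>) =
        indicator {\<omega> \<in> space palm. 0 \<in> Range (config_layer n \<omega>) \<and> I \<omega>} \<omega>"
      by (simp only: nn_integral_matching_row[OF config_layer_subset matching_config_layer])
        (simp add: indicator_def)
  qed
  also have "\<dots> = emeasure palm {\<omega> \<in> space palm. 0 \<in> Range (config_layer n \<omega>) \<and> I \<omega>}" by simp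
  finally show ?thesis .
qed

text \<open>If some point lacks an outgoing edge then only finitely many points lack an incoming one, and the
  origin is almost surely none of them. If no point lacks an outgoing edge then the origin has one, and
  it has an incoming edge with the same probability. So the origin almost surely has an incoming edge,
  and then, comparing probabilities once more, an outgoing one.\<close>

lemma AE_palm_layer:
  "AE \<omega> in palm. 0 \<in> Domain (config_layer n \<omega>) \<and> 0 \<in> Range (config_layer n \<omega>)"
proof -
  interpret palm: prob_space palm by (rule prob_space_palm)
  let ?D = "\<lambda>\<omega>. Domain (config_layer n \<omega>)" and ?R = "\<lambda>\<omega>. Range (config_layer n \<omega>)"
  let ?U = "\<lambda>\<omega>. \<exists>x\<in>\<omega>. x \<notin> ?D \<omega>"
  have [measurable]: "Measurable.pred configs (\<lambda>\<omega> :: 'a set. 0 \<in> ?D \<omega>)"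
    "Measurable.pred configs (\<lambda>\<omega> :: 'a set. 0 \<in> ?R \<omega>)"
    by measurable
  have U [measurable]: "Measurable.pred configs (\<lambda>\<omega> :: 'a set. ?U \<omega>)"
    by (rule pred_bex_points) (simp_all add: split_beta)
  have U_translate: "?U (translate_config \<omega> y) = ?U \<omega>" for \<omega> and y :: 'a
    by (simp add: translate_config_def[of \<omega>] Domain_config_layer_translate[unfolded translate_config_def])
  have deficient: "AE \<omega> in palm. \<not> (?U \<omega> \<and> 0 \<notin> ?R \<omega>)"
  proof (rule AE_palm_not_few)
    fix \<omega> :: "'a set" assume "\<omega> \<in> space configs"
    then have lf: "locally_finite \<omega>" by (simp add: space_configs)
    show "finite {y \<in> \<omega>. ?U (translate_config \<omega> y) \<and> 0 \<notin> ?R (translate_config \<omega> y)} \<and>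
        card {y \<in> \<omega>. ?U (translate_config \<omega> y) \<and> 0 \<notin> ?R (translate_config \<omega> y)} \<le> n"
    proof (cases "?U \<omega>")
      case True
      then obtain x where x: "x \<in> \<omega>" "x \<notin> ?D \<omega>" by blast
      have "{y \<in> \<omega>. ?U (translate_config \<omega> y) \<and> 0 \<notin> ?R (translate_config \<omega> y)} = \<omega> - ?R \<omega>"
        unfolding U_translate using True by (auto simp: Range_config_layer_translate)
      then show ?thesis
        using deficient_layer[OF matching_edges edges_cover[OF lf], of x n] x
        by (simp add: config_layer_def)
    next
      case False
      then show ?thesis unfolding U_translate by simp
    qed
  qed simp
  have "emeasure palm {\<omega> \<in> space palm. \<not> ?U \<omega>} =
      emeasure palm {\<omega> \<in> space palm. 0 \<in> ?D \<omega> \<and> \<not> ?U \<omega>}"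
  proof (rule emeasure_eq_AE)
    show "AE \<omega> in palm. \<omega> \<in> {\<omega> \<in> space palm. \<not> ?U \<omega>} \<longleftrightarrow> \<omega> \<in> {\<omega> \<in> space palm. 0 \<in> ?D \<omega> \<and> \<not> ?U \<omega>}"
      using AE_palm_0 by eventually_elim auto
  qed measurable
  also have "\<dots> = emeasure palm {\<omega> \<in> space palm. 0 \<in> ?R \<omega> \<and> \<not> ?U \<omega>}"
    by (rule palm_Domain_eq_Range) (simp_all only: U_translate pred_intros_logic U)
  finally have eq: "palm.prob {\<omega> \<in> space palm. \<not> ?U \<omega>} = palm.prob {\<omega> \<in> space palm. 0 \<in> ?R \<omega> \<and> \<not> ?U \<omega>}"
    by (simp add: measure_def)
  have "AE \<omega> in palm. \<not> ?U \<omega> \<longrightarrow> 0 \<in> ?R \<omega>"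
  proof -
    have "palm.prob ({\<omega> \<in> space palm. \<not> ?U \<omega>} - {\<omega> \<in> space palm. 0 \<in> ?R \<omega> \<and> \<not> ?U \<omega>}) = 0"
    proof (subst palm.finite_measure_Diff)
      show "{\<omega> \<in> space palm. \<not> ?U \<omega>} \<in> sets palm"
        "{\<omega> \<in> space palm. 0 \<in> ?R \<omega> \<and> \<not> ?U \<omega>} \<in> sets palm" by measurable
      show "palm.prob {\<omega> \<in> space palm. \<not> ?U \<omega>} - palm.prob {\<omega> \<in> space palm. 0 \<in> ?R \<omega> \<and> \<not> ?U \<omega>} = 0"
        unfolding eq by (rule diff_self)
    qed blast
    moreover have "{\<omega> \<in> space palm. \<not> ?U \<omega>} - {\<omega> \<in> space palm. 0 \<in> ?R \<omega> \<and> \<not> ?U \<omega>} =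
        {\<omega> \<in> space palm. \<not> (\<not> ?U \<omega> \<longrightarrow> 0 \<in> ?R \<omega>)}" by auto
    ultimately have "emeasure palm {\<omega> \<in> space palm. \<not> (\<not> ?U \<omega> \<longrightarrow> 0 \<in> ?R \<omega>)} = 0"
      by (simp only: palm.emeasure_eq_measure ennreal_0)
    moreover have "{\<omega> \<in> space palm. \<not> (\<not> ?U \<omega> \<longrightarrow> 0 \<in> ?R \<omega>)} \<in> sets palm" by measurable
    ultimately show ?thesis by (intro AE_I[OF order_refl])
  qed
  with deficient have range: "AE \<omega> in palm. 0 \<in> ?R \<omega>" by eventually_elim auto
  have "emeasure palm {\<omega> \<in> space palm. 0 \<in> ?D \<omega>} = emeasure palm {\<omega> \<in> space palm. 0 \<in> ?R \<omega>}"
    using palm_Domain_eq_Range[of "\<lambda>_. True" n] by simp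
  also have "\<dots> = 1" using range by (intro palm.emeasure_eq_1_AE) auto
  finally have "AE \<omega> in palm. 0 \<in> ?D \<omega>"
    by (subst palm.AE_iff_emeasure_eq_1) simp_all
  with range show ?thesis by eventually_elim simp
qed

end

section \<open>The point shifts\<close>

text \<open>The condition is put on all points, not only on the origin, so that it survives a change of origin.\<close>

definition total_configs :: "'a::euclidean_space set set" where
  "total_configs = {\<omega> \<in> space configs. 0 \<in> \<omega> \<and>
     (\<forall>n. \<forall>y\<in>\<omega>. y \<in> Domain (config_layer n \<omega>) \<and> y \<in> Range (config_layer n \<omega>))}"

definition partner :: "nat \<Rightarrow> 'a::euclidean_space set \<Rightarrow> 'a" where
  "partner n \<omega> = (THE y. (0, y) \<in> config_layer n \<omega>)"

definition shift :: "nat \<Rightarrow> 'a::euclidean_space set \<Rightarrow> 'a set" where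
  "shift n \<omega> = translate_config \<omega> (partner n \<omega>)"

lemma sets_total_configs [measurable]: "total_configs \<in> sets configs"
proof -
  have [measurable]: "Measurable.pred configs
     (\<lambda>\<omega> :: 'a set. \<forall>y\<in>\<omega>. y \<in> Domain (config_layer n \<omega>) \<and> y \<in> Range (config_layer n \<omega>))" for n
    by (rule pred_ball_points) (simp_all add: split_beta)
  show ?thesis unfolding total_configs_def by measurable
qed

lemma partner_iff:
  assumes "\<omega> \<in> total_configs"
  shows "(0, y) \<in> config_layer n \<omega> \<longleftrightarrow> y = partner n \<omega>"
proof -
  obtain z where z: "(0, z) \<in> config_layer n \<omega>"
    using assms unfolding total_configs_def by blast
  then have "partner n \<omega> = z"
    unfolding partner_def using config_layer_unique(1) by blast
  with z show ?thesis using config_layer_unique(1) by blast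
qed

lemma partner_mem: "\<omega> \<in> total_configs \<Longrightarrow> partner n \<omega> \<in> \<omega>"
  using partner_iff[of \<omega> "partner n \<omega>" n] config_layer_subset by blast

lemma partner_0: "\<omega> \<in> total_configs \<Longrightarrow> partner 0 \<omega> = 0"
  using partner_iff[of \<omega> 0 0] by (auto simp: config_layer_0 total_configs_def)

lemma inj_partner:
  assumes "\<omega> \<in> total_configs"
  shows "inj (\<lambda>n. partner n \<omega>)"
proof (rule injI)
  fix m n assume "partner m \<omega> = partner n \<omega>"
  then have "(0, partner n \<omega>) \<in> config_layer m \<omega>" "(0, partner n \<omega>) \<in> config_layer n \<omega>"
    by (simp_all add: partner_iff[OF assms])
  then have "layer (edges \<omega>) m \<inter> layer (edges \<omega>) n \<noteq> {}" unfolding config_layer_def by auto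
  then show "m = n" using layers_disjoint by metis
qed

lemma partners_exhaust:
  assumes "\<omega> \<in> total_configs"
  shows "\<omega> = range (\<lambda>n. partner n \<omega>)"
proof
  show "\<omega> \<subseteq> range (\<lambda>n. partner n \<omega>)"
  proof
    fix y assume "y \<in> \<omega>"
    have "locally_finite \<omega>" "0 \<in> \<omega>" using assms by (auto simp: total_configs_def space_configs)
    with \<open>y \<in> \<omega>\<close> obtain k where "(0, y) \<in> edges \<omega> k" using edges_cover[of \<omega>] by blast
    from layers_exhaust[of "edges \<omega>", OF matching_edges this]
    obtain n where "(0, y) \<in> config_layer n \<omega>" unfolding config_layer_def by blast
    then show "y \<in> range (\<lambda>n. partner n \<omega>)" using partner_iff[OF assms] by blast
  qed
qed (use partner_mem[OF assms] in blast)

lemma translate_total_configs: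
  assumes "\<omega> \<in> total_configs" "y \<in> \<omega>"
  shows "translate_config \<omega> y \<in> total_configs"
proof -
  have "0 \<in> translate_config \<omega> y" using assms(2) by (simp add: mem_translate_config)
  moreover have "translate_config \<omega> y \<in> space configs"
    using assms(1) by (simp add: total_configs_def space_configs locally_finite_translate)
  moreover have "x \<in> Domain (config_layer n (translate_config \<omega> y)) \<and> x \<in> Range (config_layer n (translate_config \<omega> y))"
    if "x \<in> translate_config \<omega> y" for n x
    using that assms(1)
    by (simp add: total_configs_def mem_translate_config Domain_config_layer_translate Range_config_layer_translate)
  ultimately show ?thesis unfolding total_configs_def by blast
qed

text \<open>After the shift along an edge from 0 to \<open>y\<close>, the old origin is the point \<open>- y\<close>, and it is the only one
  that the same layer joins to the new origin. So the shift can be undone.\<close>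

lemma bij_betw_shift: "bij_betw (shift n) total_configs (total_configs :: 'a::euclidean_space set set)"
  unfolding bij_betw_def
proof
  have backward: "(- partner n \<omega>, 0) \<in> config_layer n (shift n \<omega>)" if "\<omega> \<in> total_configs" for \<omega> :: "'a set"
    unfolding shift_def config_layer_translate using partner_iff[OF that, of "partner n \<omega>" n] by simp
  show "inj_on (shift n) (total_configs :: 'a set set)"
  proof (rule inj_onI)
    fix \<omega> \<omega>' :: "'a set" assume mem: "\<omega> \<in> total_configs" "\<omega>' \<in> total_configs" and eq: "shift n \<omega> = shift n \<omega>'"
    have "- partner n \<omega> = - partner n \<omega>'"
      using config_layer_unique(2)[OF backward[OF mem(1)]] backward[OF mem(2)] unfolding eq by blast
    then have p: "partner n \<omega> = partner n \<omega>'" by simp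
    have "\<omega> = translate_config (shift n \<omega>) (- partner n \<omega>)"
      by (simp add: shift_def translate_config_translate_config)
    also have "\<dots> = \<omega>'"
      unfolding eq p by (simp add: shift_def translate_config_translate_config)
    finally show "\<omega> = \<omega>'" .
  qed
  show "shift n ` total_configs = (total_configs :: 'a set set)"
  proof
    show "shift n ` total_configs \<subseteq> (total_configs :: 'a set set)"
      unfolding shift_def using translate_total_configs partner_mem by blast
    show "(total_configs :: 'a set set) \<subseteq> shift n ` total_configs"
    proof
      fix \<eta> :: "'a set" assume total: "\<eta> \<in> total_configs"
      then obtain y where y: "(y, 0) \<in> config_layer n \<eta>" unfolding total_configs_def by blast
      then have "y \<in> \<eta>" using config_layer_subset by blast
      then have mem: "translate_config \<eta> y \<in> total_configs" by (rule translate_total_configs[OF total])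
      have "(0, - y) \<in> config_layer n (translate_config \<eta> y)" using y by (simp add: config_layer_translate)
      then have "partner n (translate_config \<eta> y) = - y" using partner_iff[OF mem] by simp
      then have "shift n (translate_config \<eta> y) = \<eta>"
        by (simp add: shift_def translate_config_translate_config)
      with mem show "\<eta> \<in> shift n ` total_configs" by (metis imageI)
    qed
  qed
qed

lemma measurable_partner: "partner n \<in> restrict_space configs total_configs \<rightarrow>\<^sub>M (borel :: 'a::euclidean_space measure)"
proof (rule measurableI)
  fix A :: "'a set" assume [measurable]: "A \<in> sets borel"
  have [measurable]: "Measurable.pred configs (\<lambda>\<omega> :: 'a set. \<exists>y\<in>\<omega>. (0, y) \<in> config_layer n \<omega> \<and> y \<in> A)"
    by (rule pred_bex_points) (simp_all add: split_beta)
  have "partner n -` A \<inter> space (restrict_space configs total_configs) =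
      {\<omega> \<in> total_configs. \<exists>y\<in>\<omega>. (0, y) \<in> config_layer n \<omega> \<and> y \<in> A}"
  proof -
    have "space (restrict_space configs total_configs) = (total_configs :: 'a set set)"
      using sets.sets_into_space[OF sets_total_configs] by (auto simp: space_restrict_space)
    moreover have "partner n \<omega> \<in> A \<longleftrightarrow> (\<exists>y\<in>\<omega>. (0, y) \<in> config_layer n \<omega> \<and> y \<in> A)"
      if "\<omega> \<in> total_configs" for \<omega>
      using partner_mem[OF that] by (auto simp: partner_iff[OF that])
    ultimately show ?thesis by blast
  qed
  also have "\<dots> = total_configs \<inter> {\<omega> \<in> space configs. \<exists>y\<in>\<omega>. (0, y) \<in> config_layer n \<omega> \<and> y \<in> A}"
    by (auto simp: total_configs_def)
  also have "\<dots> \<in> sets (restrict_space configs total_configs)"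
    unfolding sets_restrict_space by (intro imageI) measurable
  finally show "partner n -` A \<inter> space (restrict_space configs total_configs) \<in>
    sets (restrict_space configs total_configs)" .
qed simp

lemma measurable_shift: "shift n \<in> restrict_space configs total_configs \<rightarrow>\<^sub>M (configs :: 'a::euclidean_space set measure)"
proof -
  note [measurable] = measurable_partner
  have [measurable]: "(\<lambda>\<omega>. \<omega>) \<in> restrict_space configs total_configs \<rightarrow>\<^sub>M (configs :: 'a set measure)"
    by (rule measurable_restrict_space1) simp
  show ?thesis unfolding shift_def[abs_def] by measurable
qed

lemma sets_shift:
  assumes "A \<in> sets (configs :: 'a::euclidean_space set measure)"
  shows "{\<omega> \<in> total_configs. shift n \<omega> \<in> A} \<in> sets configs"
proof -
  have "{\<omega> \<in> total_configs. shift n \<omega> \<in> A} = shift n -` A \<inter> space (restrict_space configs total_configs)"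
    using sets.sets_into_space[OF sets_total_configs] by (auto simp: space_restrict_space)
  also have "\<dots> \<in> sets (restrict_space configs total_configs)"
    by (rule measurable_sets[OF measurable_shift assms])
  finally show ?thesis by (simp add: sets_restrict_space_iff)
qed

context poisson_law
begin

lemma AE_palm_total: "AE \<omega> in palm. \<omega> \<in> total_configs"
proof -
  let ?T = "\<lambda>n \<omega> :: 'a set. 0 \<in> Domain (config_layer n \<omega>) \<and> 0 \<in> Range (config_layer n \<omega>)"
  have "AE \<omega> in palm. \<forall>y\<in>\<omega>. ?T n (translate_config \<omega> y)" for n
    by (rule AE_palm_all_points) (simp, rule AE_palm_layer)
  then have "AE \<omega> in palm. \<forall>n. \<forall>y\<in>\<omega>. ?T n (translate_config \<omega> y)" by (simp add: AE_all_countable)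
  with AE_palm_0 AE_space show ?thesis
    by eventually_elim (simp add: total_configs_def Domain_config_layer_translate Range_config_layer_translate)
qed

text \<open>Let 0 send mass 1 to its partner when the shifted configuration lies in \<open>A\<close>. Seen from the receiving
  point the condition is that its own configuration lies in \<open>A\<close>, and it receives from exactly one point.\<close>

lemma palm_shift_invariant:
  assumes A [measurable]: "A \<in> sets configs"
  shows "emeasure palm {\<omega> \<in> total_configs. shift n \<omega> \<in> A} = emeasure palm A"
proof -
  let ?Q = "\<lambda>p :: 'a set \<times> 'a. fst p \<in> total_configs \<and> (0, snd p) \<in> config_layer n (fst p) \<and>
    translate_config (fst p) (snd p) \<in> A"
  let ?g = "\<lambda>p. if ?Q p then 1 else 0 :: ennreal"
  note row = nn_integral_matching_row[OF config_layer_subset matching_config_layer]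
  have set: "{\<omega> \<in> total_configs. shift n \<omega> \<in> A} \<in> sets configs" by (rule sets_shift) fact
  have "emeasure palm {\<omega> \<in> total_configs. shift n \<omega> \<in> A} =
      (\<integral>\<^sup>+\<omega>. indicator {\<omega> \<in> total_configs. shift n \<omega> \<in> A} \<omega> \<partial>palm)" using set by simp
  also have "\<dots> = (\<integral>\<^sup>+\<omega>. \<integral>\<^sup>+y. ?g (\<omega>, y) \<partial>count_space \<omega> \<partial>palm)"
  proof (rule nn_integral_cong)
    fix \<omega> :: "'a set"
    have "(\<integral>\<^sup>+y. ?g (\<omega>, y) \<partial>count_space \<omega>) =
        (\<integral>\<^sup>+y. indicator {y. (0, y) \<in> config_layer n \<omega> \<and> \<omega> \<in> total_configs \<and> shift n \<omega> \<in> A} y \<partial>count_space \<omega>)"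
      by (intro nn_integral_cong) (auto simp: indicator_def partner_iff shift_def)
    also have "\<dots> = (if 0 \<in> Domain (config_layer n \<omega>) \<and> \<omega> \<in> total_configs \<and> shift n \<omega> \<in> A then 1 else 0)"
      by (rule row)
    also have "\<dots> = indicator {\<omega> \<in> total_configs. shift n \<omega> \<in> A} \<omega>"
    proof -
      have "0 \<in> Domain (config_layer n \<omega>)" if "\<omega> \<in> total_configs"
        using that unfolding total_configs_def by blast
      then show ?thesis by (auto simp: indicator_def)
    qed
    finally show "indicator {\<omega> \<in> total_configs. shift n \<omega> \<in> A} \<omega> = (\<integral>\<^sup>+y. ?g (\<omega>, y) \<partial>count_space \<omega>)" ..
  qed
  also have "\<dots> = (\<integral>\<^sup>+\<omega>. \<integral>\<^sup>+y. ?g (translate_config \<omega> y, - y) \<partial>count_space \<omega> \<partial>palm)"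
    by (rule mass_transport) measurable
  also have "\<dots> = (\<integral>\<^sup>+\<omega>. indicator A \<omega> \<partial>palm)"
  proof (rule nn_integral_cong_AE)
    show "AE \<omega> in palm. (\<integral>\<^sup>+y. ?g (translate_config \<omega> y, - y) \<partial>count_space \<omega>) = indicator A \<omega>"
      using AE_palm_total
    proof eventually_elim
      case (elim \<omega>)
      have "(\<integral>\<^sup>+y. ?g (translate_config \<omega> y, - y) \<partial>count_space \<omega>) =
          (\<integral>\<^sup>+y. indicator {y. (y, 0) \<in> config_layer n \<omega> \<and> \<omega> \<in> A} y \<partial>count_space \<omega>)"
        using translate_total_configs[OF elim]
        by (intro nn_integral_cong) (auto simp: indicator_def config_layer_translate translate_config_translate_config)
      also have "\<dots> = (if 0 \<in> Range (config_layer n \<omega>) \<and> \<omega> \<in> A then 1 else 0)" by (rule row)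
      also have "\<dots> = indicator A \<omega>" using elim by (auto simp: total_configs_def)
      finally show ?case .
    qed
  qed
  also have "\<dots> = emeasure palm A" by simp
  finally show ?thesis .
qed

end

theorem mainTheorem2:
  fixes M :: "'p measure" and N :: "'q measure"
    and S :: "'p \<Rightarrow> (real ^ 'd) set" and S0 :: "'q \<Rightarrow> (real ^ 'd) set"
    and lam :: real
  assumes "CARD('d) \<in> {2, 3}"
    and "homogeneous_poisson_process M S lam"
    and "palm_version M S N S0"
  shows "\<exists>(\<S> :: (real ^ 'd) set set) (\<pi> :: int \<Rightarrow> (real ^ 'd) set \<Rightarrow> real ^ 'd).
           \<S> \<in> sets configs \<and>
           (\<forall>\<omega>\<in>\<S>. 0 \<in> \<omega>) \<and>
           measure N {x \<in> space N. S0 x \<in> \<S>} = 1 \<and>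
           (\<forall>n. \<pi> n \<in> restrict_space configs \<S> \<rightarrow>\<^sub>M borel) \<and>
           (\<forall>\<omega>\<in>\<S>. \<pi> 0 \<omega> = 0) \<and>
           (\<forall>\<omega>\<in>\<S>. inj (\<lambda>n. \<pi> n \<omega>) \<and> \<omega> = range (\<lambda>n. \<pi> n \<omega>)) \<and>
           (\<forall>n. bij_betw (\<lambda>\<omega>. translate_config \<omega> (\<pi> n \<omega>)) \<S> \<S>) \<and>
           (\<forall>n. same_distribution configs
                  (restrict_space N {x \<in> space N. S0 x \<in> \<S>})
                  (\<lambda>x. translate_config (S0 x) (\<pi> n (S0 x)))
                  N S0)"
proof -
  define P where "P = distr M configs S"
  interpret poisson_law P lam unfolding P_def by (rule poisson_law_distr) fact
  interpret palm: prob_space palm by (rule prob_space_palm)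
  have S [measurable]: "S \<in> M \<rightarrow>\<^sub>M configs" using assms(2) by (simp add: homogeneous_poisson_process_def)
  have S0 [measurable]: "S0 \<in> N \<rightarrow>\<^sub>M configs" and "prob_space N"
    and "distr N configs S0 = distr M configs (\<lambda>x. S x \<union> {0})"
    using assms(3) by (auto simp: palm_version_def same_distribution_def)
  then interpret N: prob_space N by simp
  have palm: "distr N configs S0 = palm"
  proof -
    have "distr P configs (insert 0) = distr M configs (\<lambda>x. S x \<union> {0})"
      unfolding P_def by (subst distr_distr) (simp_all add: comp_def)
    then show ?thesis
      by (simp only: palm_def \<open>distr N configs S0 = distr M configs (\<lambda>x. S x \<union> {0})\<close>)
  qed
  let ?S = "total_configs :: (real ^ 'd) set set"
  let ?E = "{x \<in> space N. S0 x \<in> ?S}"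
  let ?\<pi> = "\<lambda>n :: int. partner (int_encode n) :: (real ^ 'd) set \<Rightarrow> real ^ 'd"
  have pull: "emeasure N {x \<in> space N. S0 x \<in> A} = emeasure palm A" if "A \<in> sets configs" for A
    unfolding palm[symmetric] using that
    by (subst emeasure_distr) (auto intro!: arg_cong[where f = "emeasure N"])
  have E [measurable]: "?E \<in> sets N" by measurable
  have "emeasure N ?E = 1"
    using pull[OF sets_total_configs] AE_palm_total palm.emeasure_eq_1_AE[of total_configs] by simp
  then have prob: "measure N ?E = 1" by (simp add: measure_def)
  have "same_distribution configs (restrict_space N ?E) (\<lambda>x. shift n (S0 x)) N S0" for n
    unfolding same_distribution_def
  proof (intro conjI measure_eqI)
    have S0': "S0 \<in> restrict_space N ?E \<rightarrow>\<^sub>M restrict_space configs total_configs"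
      by (rule measurable_restrict_space3[OF S0]) auto
    from measurable_compose[OF S0' measurable_shift]
    show m: "(\<lambda>x. shift n (S0 x)) \<in> restrict_space N ?E \<rightarrow>\<^sub>M configs" .
    fix A assume "A \<in> sets (distr (restrict_space N ?E) configs (\<lambda>x. shift n (S0 x)))"
    then have A: "A \<in> sets configs" by simp
    have set: "{\<omega> \<in> total_configs. shift n \<omega> \<in> A} \<in> sets (configs :: (real ^ 'd) set measure)"
      by (rule sets_shift) fact
    have "emeasure (distr (restrict_space N ?E) configs (\<lambda>x. shift n (S0 x))) A =
        emeasure N {x \<in> space N. S0 x \<in> {\<omega> \<in> total_configs. shift n \<omega> \<in> A}}"
      unfolding emeasure_distr[OF m A]
      by (subst emeasure_restrict_space)
        (auto simp: space_restrict_space intro!: arg_cong[where f = "emeasure N"])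
    also have "\<dots> = emeasure palm A" unfolding pull[OF set] by (rule palm_shift_invariant[OF A])
    finally show "emeasure (distr (restrict_space N ?E) configs (\<lambda>x. shift n (S0 x))) A =
      emeasure (distr N configs S0) A" unfolding palm .
  qed (simp_all add: S0)
  then have dist: "same_distribution configs (restrict_space N ?E)
      (\<lambda>x. translate_config (S0 x) (?\<pi> n (S0 x))) N S0" for n
    by (simp add: shift_def)
  have inj: "inj (\<lambda>n. ?\<pi> n \<omega>)" and range: "\<omega> = range (\<lambda>n. ?\<pi> n \<omega>)" if "\<omega> \<in> ?S" for \<omega>
  proof -
    show "inj (\<lambda>n. ?\<pi> n \<omega>)"
      using inj_compose[OF inj_partner[OF that] inj_int_encode] by (simp add: comp_def)
    have "range (\<lambda>n. ?\<pi> n \<omega>) = (\<lambda>n. partner n \<omega>) ` range int_encode" by (simp add: image_image)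
    then show "\<omega> = range (\<lambda>n. ?\<pi> n \<omega>)" using partners_exhaust[OF that] by (simp add: surj_int_encode)
  qed
  have zero: "?\<pi> 0 \<omega> = 0" if "\<omega> \<in> ?S" for \<omega>
    using partner_0[OF that] by (simp add: int_encode_def sum_encode_def)
  have bij: "bij_betw (\<lambda>\<omega>. translate_config \<omega> (?\<pi> n \<omega>)) ?S ?S" for n
    using bij_betw_shift unfolding shift_def[abs_def] .
  show ?thesis
  proof (rule exI[of _ ?S], rule exI[of _ ?\<pi>], intro conjI allI ballI)
    fix n :: int
    show "?S \<in> sets configs" by (rule sets_total_configs)
    show "measure N ?E = 1" by (rule prob)
    show "?\<pi> n \<in> restrict_space configs ?S \<rightarrow>\<^sub>M borel" by (rule measurable_partner)
    show "bij_betw (\<lambda>\<omega>. translate_config \<omega> (?\<pi> n \<omega>)) ?S ?S" by (rule bij)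
    show "same_distribution configs (restrict_space N ?E) (\<lambda>x. translate_config (S0 x) (?\<pi> n (S0 x))) N S0"
      by (rule dist)
  next
    fix \<omega> assume \<omega>: "\<omega> \<in> ?S"
    show "0 \<in> \<omega>" using \<omega> by (simp add: total_configs_def)
    show "?\<pi> 0 \<omega> = 0" by (rule zero[OF \<omega>])
    show "inj (\<lambda>n. ?\<pi> n \<omega>)" by (rule inj[OF \<omega>])
    show "\<omega> = range (\<lambda>n. ?\<pi> n \<omega>)" by (rule range[OF \<omega>])
  qed
qed

end
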